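(* Let $n\ge 2$, let $H\colon\mathbb{R}^n\to\mathbb{R}$ be a smooth function and let $a<b$ be real numbers. For any integrable Borel function $f\colon\mathbb{R}^n\to\mathbb{R}$, $$\int_{H^{-1}([a,b])} f\,d\lambda^{n}=\int_{a}^{b}\int_{H^{-1}(\{t\})}\frac{f}{|\nabla H|}\,d\mathcal{H}_{n-1\leq n}\,dt,$$ where $\mathcal{H}_{n-1\leq n}$ is the inductive volume measure of local dimension $n-1$ and ambient dimension $n$.
   Context: $\lambda^n$ is Lebesgue measure on $\mathbb{R}^n$. The inner integral is considered for regular values $t$ of $H$, which by Sard's theorem is almost every $t$. Submanifold of $\mathbb{R}^n$ means embedded $C^1$ submanifold without boundary (not necessarily closed or connected), with the Riemannian metric induced from $\mathbb{R}^n$. For an $m$-dimensional submanifold $M$, $\mu_M$ is its volume measure: the unique Borel measure on $M$ such that for every local parametrization $\varphi\colon U\subset\mathbb{R}^m\to M$ and Borel $E\subset U$, $\mu_M(\varphi(E))=\int_E\sqrt{\det(D\varphi^{t}D\varphi)}\,dx$. Definition of $\mathcal{H}_{m\leq n}$ (positive integers $m\le n$). Let $\mathcal{C}_m$ be the class of Borel subsets of $\mathbb{R}^n$ contained in some $m$-dimensional submanifold. For $C\in\mathcal{C}_m$ with $C\subset S$, $S$ such a submanifold, put $\mu_C(A)=\mu_S(A\cap C)$ for Borel $A$ (independent of $S$). Let $I_m$ be the class of finite disjoint unions $\tilde M=\biguplus_{i=1}^{k}C_i$ of elements of $\mathcal{C}_m$, directed by inclusion, and put $\mu_{\tilde M}=\sum_{i=1}^{k}\mu_{C_i}$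 (independent of the decomposition). The inductive volume measure is $$\mathcal{H}_{m\leq n}(A)=\lim_{\tilde M\in I_m}\mu_{\tilde M}(A)=\sup_{\tilde M\in I_m}\mu_{\tilde M}(A),\qquad A\in Bo(\mathbb{R}^n),$$ a measure on the Borel $\sigma$-algebra $Bo(\mathbb{R}^n)$.
   Formalization: Assumes in addition that the critical points of H in H^{-1}([a,b]) form a Lebesgue-null set; without this the claim fails, e.g. for H = 0, a = -1, b = 1 and f the indicator of the unit cube (left side 1, right side 0). *)

theory Defs
  imports "HOL-Analysis.Analysis"
begin

text \<open>The dimensions \<open>m \<le> n\<close> are the cardinalities of the index types \<open>'m\<close> and \<open>'n\<close>.
  Where \<open>'m\<close> does not occur in the remaining arguments it is passed as \<open>TYPE('m)\<close>.\<close>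

section \<open>Functions of class \<open>C\<^sup>k\<close>\<close>

text \<open>Intended for open \<open>S\<close>. In finite dimension, continuity of all directional derivatives
  (of order up to \<open>k\<close>) is continuity of the (higher) Frechet derivatives.\<close>

primrec Ck_on :: "nat \<Rightarrow> 'a::euclidean_space set \<Rightarrow> ('a \<Rightarrow> 'b::euclidean_space) \<Rightarrow> bool" where
  "Ck_on 0 S f \<longleftrightarrow> continuous_on S f"
| "Ck_on (Suc k) S f \<longleftrightarrow>
     (\<forall>x\<in>S. f differentiable (at x)) \<and>
     (\<forall>v. Ck_on k S (\<lambda>x. frechet_derivative f (at x) v))"

definition smooth :: "('a::euclidean_space \<Rightarrow> 'b::euclidean_space) \<Rightarrow> bool" where
  "smooth f \<longleftrightarrow> (\<forall>k. Ck_on k UNIV f)"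

definition grad :: "(real ^ 'n \<Rightarrow> real) \<Rightarrow> real ^ 'n::finite \<Rightarrow> real ^ 'n" where
  "grad H x = (\<chi> i. frechet_derivative H (at x) (axis i 1))"

section \<open>Submanifolds and their volume measure\<close>

definition local_parametrization ::
    "(real ^ 'n::finite) set \<Rightarrow> (real ^ 'm::finite) set \<Rightarrow> (real ^ 'm \<Rightarrow> real ^ 'n) \<Rightarrow> bool" where
  "local_parametrization M U \<phi> \<longleftrightarrow>
     open U \<and> Ck_on 1 U \<phi> \<and>
     (\<forall>x\<in>U. inj (frechet_derivative \<phi> (at x))) \<and>
     (\<exists>\<psi>. homeomorphism U (\<phi> ` U) \<phi> \<psi>) \<and>
     openin (top_of_set M) (\<phi> ` U)"

definition submanifold :: "'m::finite itself \<Rightarrow> (real ^ 'n::finite) set \<Rightarrow> bool" where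
  "submanifold _ M \<longleftrightarrow>
     (\<forall>p\<in>M. \<exists>(U :: (real ^ 'm) set) \<phi>. local_parametrization M U \<phi> \<and> p \<in> \<phi> ` U)"

definition gram_density :: "(real ^ 'm::finite \<Rightarrow> real ^ 'n::finite) \<Rightarrow> real ^ 'm \<Rightarrow> real" where
  "gram_density \<phi> x =
     (let D = matrix (frechet_derivative \<phi> (at x)) in sqrt (det (transpose D ** D)))"

definition is_volume_measure ::
    "'m::finite itself \<Rightarrow> (real ^ 'n::finite) set \<Rightarrow> (real ^ 'n) measure \<Rightarrow> bool" where
  "is_volume_measure _ M \<mu> \<longleftrightarrow>
     space \<mu> = M \<and> sets \<mu> = sets (restrict_space borel M) \<and>
     (\<forall>(U :: (real ^ 'm) set) \<phi> E.
        local_parametrization M U \<phi> \<longrightarrow> E \<in> sets borel \<longrightarrow> E \<subseteq> U \<longrightarrow>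
        emeasure \<mu> (\<phi> ` E) = (\<integral>\<^sup>+x\<in>E. ennreal (gram_density \<phi> x) \<partial>lborel))"

definition volume_measure ::
    "'m::finite itself \<Rightarrow> (real ^ 'n::finite) set \<Rightarrow> (real ^ 'n) measure" where
  "volume_measure T M = (THE \<mu>. is_volume_measure T M \<mu>)"

section \<open>The inductive volume measure\<close>

definition pieces :: "'m::finite itself \<Rightarrow> (real ^ 'n::finite) set set" where
  "pieces T = {C. C \<in> sets borel \<and> (\<exists>S. submanifold T S \<and> C \<subseteq> S)}"

text \<open>Mathematically, \<open>piece_volume\<close> does not depend on the submanifold, nor
  \<open>union_volume\<close> on the decomposition, that the choice operator selects.\<close>

definition piece_volume ::
    "'m::finite itself \<Rightarrow> (real ^ 'n::finite) set \<Rightarrow> (real ^ 'n) set \<Rightarrow> ennreal" where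
  "piece_volume T C A =
     emeasure (volume_measure T (SOME S. submanifold T S \<and> C \<subseteq> S)) (A \<inter> C)"

definition decomposition ::
    "'m::finite itself \<Rightarrow> (real ^ 'n::finite) set set \<Rightarrow> (real ^ 'n) set \<Rightarrow> bool" where
  "decomposition T P M \<longleftrightarrow> finite P \<and> P \<subseteq> pieces T \<and> disjoint P \<and> \<Union>P = M"

definition piece_unions :: "'m::finite itself \<Rightarrow> (real ^ 'n::finite) set set" where
  "piece_unions T = {M. \<exists>P. decomposition T P M}"

definition union_volume ::
    "'m::finite itself \<Rightarrow> (real ^ 'n::finite) set \<Rightarrow> (real ^ 'n) set \<Rightarrow> ennreal" where
  "union_volume T M A = (\<Sum>C\<in>(SOME P. decomposition T P M). piece_volume T C A)"

text \<open>The measure \<open>\<H>\<close> of local dimension \<open>CARD('m)\<close> and ambient dimension \<open>CARD('n)\<close>.\<close>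

definition inductive_volume :: "'m::finite itself \<Rightarrow> (real ^ 'n::finite) measure" where
  "inductive_volume T =
     measure_of UNIV (sets borel) (\<lambda>A. SUP M\<in>piece_unions T. union_volume T M A)"

end

theory Submission
  imports Defs
begin

text \<open>Where \<open>\<nabla>H \<noteq> 0\<close>, some partial derivative \<open>\<partial>\<^sub>i H\<close> is nonzero, and replacing the \<open>i\<close>-th
  coordinate by \<open>H\<close> is a local diffeomorphism with Jacobian \<open>\<bar>\<partial>\<^sub>i H\<bar>\<close>. Its inverse parametrizes the level
  sets of \<open>H\<close> with Gram density \<open>\<bar>\<nabla>H\<bar> / \<bar>\<partial>\<^sub>i H\<bar>\<close>, so the change of variables formula and Fubini's theorem
  give the claim locally; a countable cover gives it on \<open>{\<nabla>H \<noteq> 0}\<close>. Sard's theorem is not needed: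
  since \<open>x / 0 = 0\<close>, critical points contribute nothing to the inner integral.

  On each parametrized piece the inductive volume is the integral of the Gram density. This rests on the
  independence of that integral from the parametrization, even if two submanifolds share only a Borel
  set. The transition map between the two parametrizations is then differentiable merely within a Borel
  set, so the chain rule for it holds only up to a null set, on which derivatives within a set fail to be
  unique.\<close>

text \<open>With \<open>CARD('m) = CARD('n) - 1\<close> the measure \<open>inductive_volume\<close>
  is not sigma-finite: uncountably many parallel hyperplanes carry positive mass. Tonelli's theorem
  is therefore never applied to it. Every slice integral is first rewritten, through one chart, as a
  Lebesgue integral over \<open>real ^ 'm\<close>, and only then integrated over the levels.

  The weight is what makes the two sides meet: Gram density times
  \<open>inverse (norm (G x))\<close> leaves the inverse absolute value of one partial derivative,
  which is exactly the Jacobian of the inverse of the straightening map.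

  The definitions of the volumes go through \<open>THE\<close> and \<open>SOME\<close>. Nothing is
  known about the selected submanifold or decomposition, so each selected quantity is identified
  with the value of one measure glued from countably many charts. Finitely many pieces have a common
  countable cover, which makes the selections comparable, although charts from different
  submanifolds may overlap in a set that is open in neither.\<close>

section \<open>Change of variables for finite index types\<close>

text \<open>The change of variables theorems of the library require an index type of class \<open>wellorder\<close>. A
  copy of the given finite type carries such an order.\<close>

typedef 'a enumerated = "UNIV :: 'a::finite set"
  morphisms of_enumerated to_enumerated ..

lemmas [simp] = of_enumerated_inverse to_enumerated_inverse[OF UNIV_I]

lemma bij_of_enumerated: "bij of_enumerated"
  by (rule bij_betw_byWitness[where f' = to_enumerated]) simp_all

instance enumerated :: (finite) finite
proof
  show "finite (UNIV :: 'a enumerated set)"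
    using bij_betw_finite[OF bij_of_enumerated[where 'a = 'a]] by simp
qed

text \<open>The order is pulled back along an arbitrary injection into \<open>nat\<close>; induction
  along it is then measure induction.\<close>

definition enum_rank :: "'a::finite enumerated \<Rightarrow> nat" where
  "enum_rank x = (SOME f. inj f) (of_enumerated x)"

lemma inj_enum_rank: "inj (enum_rank :: 'a::finite enumerated \<Rightarrow> nat)"
proof -
  obtain f :: "'a \<Rightarrow> nat" where "inj f"
    using finite_imp_inj_to_nat_seg[of "UNIV :: 'a set"] by auto
  then have "inj (SOME f :: 'a \<Rightarrow> nat. inj f)"
    by (rule someI[where P = inj])
  from inj_compose[OF this bij_is_inj[OF bij_of_enumerated]] show ?thesis
    unfolding enum_rank_def o_def .
qed

instantiation enumerated :: (finite) wellorder
begin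

definition less_eq_enumerated :: "'a enumerated \<Rightarrow> 'a enumerated \<Rightarrow> bool" where
  "x \<le> y \<longleftrightarrow> enum_rank x \<le> enum_rank y"

definition less_enumerated :: "'a enumerated \<Rightarrow> 'a enumerated \<Rightarrow> bool" where
  "x < y \<longleftrightarrow> enum_rank x < enum_rank y"

instance
proof
  fix P :: "'a enumerated \<Rightarrow> bool" and a
  assume step: "\<And>x. (\<And>y. y < x \<Longrightarrow> P y) \<Longrightarrow> P x"
  show "P a"
  proof (induction a rule: measure_induct_rule[where f = enum_rank])
    case (less x)
    show ?case
      by (rule step, rule less) (simp only: less_enumerated_def)
  qed
next
  fix x y :: "'a enumerated"
  assume "x \<le> y" "y \<le> x"
  then show "x = y"
    by (intro injD[OF inj_enum_rank]) (simp add: less_eq_enumerated_def)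
qed (unfold less_eq_enumerated_def less_enumerated_def, linarith+)

end

text \<open>Conjugation with \<open>\<pi>\<close> is a bijection between the permutation groups of
  the two index types; it preserves signs and merely reorders each product in the Leibniz
  formula.\<close>

lemma det_reindex:
  fixes A :: "'a::comm_ring_1^'n^'n" and \<pi> :: "'m::finite \<Rightarrow> 'n::finite"
  assumes "bij \<pi>"
  shows "det (\<chi> i j. A $ \<pi> i $ \<pi> j) = det A"
proof -
  let ?h = "map_permutation UNIV \<pi>"
  have bij: "bij_betw ?h {p. p permutes (UNIV :: 'm set)} {p. p permutes (UNIV :: 'n set)}"
  proof (rule bij_betw_byWitness[where f' = "map_permutation UNIV (inv \<pi>)"])
    show "\<forall>p\<in>{p. p permutes UNIV}. map_permutation UNIV (inv \<pi>) (?h p) = p"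
      using map_permutation_compose_inv[OF assms] assms by (simp add: bij_is_inj)
    show "\<forall>p\<in>{p. p permutes UNIV}. ?h (map_permutation UNIV (inv \<pi>) p) = p"
      using map_permutation_compose_inv[OF bij_imp_bij_inv[OF assms], where g = \<pi>] assms
      by (simp add: bij_is_surj surj_f_inv_f)
  qed (use map_permutation_permutes[OF assms] map_permutation_permutes[OF bij_imp_bij_inv[OF assms]] in auto)
  have "det A = (\<Sum>p | p permutes (UNIV :: 'm set).
      of_int (sign (?h p)) * (\<Prod>i\<in>UNIV. A $ i $ ?h p i))"
    unfolding det_def by (rule sum.reindex_bij_betw[OF bij, symmetric])
  also have "\<dots> = (\<Sum>p | p permutes (UNIV :: 'm set).
      of_int (sign p) * (\<Prod>i\<in>UNIV. A $ \<pi> i $ \<pi> (p i)))"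
  proof (rule sum.cong[OF refl], clarify)
    fix p :: "'m \<Rightarrow> 'm" assume p: "p permutes UNIV"
    have "(\<Prod>i\<in>UNIV. A $ i $ ?h p i) = (\<Prod>i\<in>UNIV. A $ \<pi> i $ ?h p (\<pi> i))"
      by (rule prod.reindex_bij_betw[OF assms, symmetric])
    also have "\<dots> = (\<Prod>i\<in>UNIV. A $ \<pi> i $ \<pi> (p i))"
      using assms by (simp add: map_permutation_apply bij_is_inj)
    finally show "of_int (sign (?h p)) * (\<Prod>i\<in>UNIV. A $ i $ ?h p i)
        = of_int (sign p) * (\<Prod>i\<in>UNIV. A $ \<pi> i $ \<pi> (p i))"
      using sign_map_permutation[OF _ p, of \<pi>] assms by (simp add: bij_is_inj)
  qed
  finally show ?thesis
    by (simp add: det_def)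
qed

text \<open>\<open>T\<close> matches coordinates bijectively, so the preimage of a box is a box with
  the same side lengths in another order, and boxes determine \<open>lborel\<close>. The two uses
  are the renaming of indices and the identification of \<open>(real ^ 'm) \<times> real\<close>
  with \<open>real ^ 'n\<close>.\<close>

lemma lborel_distr_basis_bij:
  fixes T :: "'a::euclidean_space \<Rightarrow> 'b::euclidean_space"
  assumes T: "linear T" "bij_betw T Basis Basis"
  shows "distr lborel borel T = lborel"
proof (rule lborel_eqI[symmetric])
  have [measurable]: "T \<in> borel_measurable borel"
    using T(1) by (simp add: borel_measurable_continuous_onI linear_continuous_on linear_linear)
  have inner: "T x \<bullet> T b = x \<bullet> b" if b: "b \<in> Basis" for x b
  proof -
    have "T x \<bullet> T b = (\<Sum>c\<in>Basis. (x \<bullet> c) * (T c \<bullet> T b))"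
      by (subst euclidean_representation[of x, symmetric])
         (simp only: linear_sum[OF T(1)] linear_scale[OF T(1)] inner_sum_left inner_scaleR_left)
    also have "\<dots> = (\<Sum>c\<in>Basis. (x \<bullet> c) * (if c = b then 1 else 0))"
    proof (rule sum.cong[OF refl])
      fix c :: 'a assume "c \<in> Basis"
      then show "(x \<bullet> c) * (T c \<bullet> T b) = (x \<bullet> c) * (if c = b then 1 else 0)"
        using inner_Basis[of "T c" "T b"] T(2) b bij_betwE[OF T(2)]
          inj_on_eq_iff[OF bij_betw_imp_inj_on[OF T(2)], of c b] by auto
    qed
    finally show ?thesis
      using b by (simp add: if_distrib[of "(*) _"] sum.delta cong: if_cong)
  qed
  fix l u :: 'b
  assume le: "\<And>b. b \<in> Basis \<Longrightarrow> l \<bullet> b \<le> u \<bullet> b"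
  define l' u' where "l' = (\<Sum>c\<in>Basis. (l \<bullet> T c) *\<^sub>R c)" and "u' = (\<Sum>c\<in>Basis. (u \<bullet> T c) *\<^sub>R c)"
  have l'u': "l' \<bullet> c = l \<bullet> T c" "u' \<bullet> c = u \<bullet> T c" if "c \<in> Basis" for c
    using that by (simp_all add: l'_def u'_def)
  have im: "T c \<in> Basis" if "c \<in> Basis" for c
    using bij_betwE[OF T(2)] that by blast
  have "T -` box l u = box l' u'"
  proof -
    have "(\<forall>b\<in>Basis. l \<bullet> b < T x \<bullet> b \<and> T x \<bullet> b < u \<bullet> b)
        \<longleftrightarrow> (\<forall>c\<in>Basis. l \<bullet> T c < T x \<bullet> T c \<and> T x \<bullet> T c < u \<bullet> T c)" for x
      by (subst bij_betw_imp_surj_on[OF T(2), symmetric]) (simp only: ball_simps)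
    then show ?thesis
      by (auto simp: box_def inner l'u')
  qed
  then have "emeasure (distr lborel borel T) (box l u) = emeasure lborel (box l' u')"
    by (simp add: emeasure_distr)
  also have "\<dots> = (\<Prod>c\<in>Basis. (u' - l') \<bullet> c)"
    using le im by (intro emeasure_lborel_box) (simp add: l'u')
  also have "(\<Prod>c\<in>Basis. (u' - l') \<bullet> c) = (\<Prod>c\<in>Basis. (u - l) \<bullet> T c)"
    by (rule prod.cong) (auto simp: l'u' inner_diff_left)
  also have "\<dots> = (\<Prod>b\<in>Basis. (u - l) \<bullet> b)"
    by (rule prod.reindex_bij_betw[OF T(2)])
  finally show "emeasure (distr lborel borel T) (box l u) = (\<Prod>b\<in>Basis. (u - l) \<bullet> b)" .
qed simp

section \<open>Transport along the ordered copy of the index type\<close>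

definition reindex :: "real ^ 'n::finite \<Rightarrow> real ^ 'n enumerated" where
  "reindex x = (\<chi> k. x $ of_enumerated k)"

definition unindex :: "real ^ 'n enumerated \<Rightarrow> real ^ 'n::finite" where
  "unindex y = (\<chi> i. y $ to_enumerated i)"

lemma unindex_reindex [simp]: "unindex (reindex x) = x"
  and reindex_unindex [simp]: "reindex (unindex y) = y"
  by (simp_all add: reindex_def unindex_def vec_eq_iff)

lemma linear_reindex: "linear reindex" and linear_unindex: "linear unindex"
  by (auto intro!: linearI simp: reindex_def unindex_def vec_eq_iff)

lemma reindex_axis: "reindex (axis i c) = axis (to_enumerated i) c"
  and unindex_axis: "unindex (axis k c) = axis (of_enumerated k) c"
  by (auto simp: reindex_def unindex_def axis_def vec_eq_iff)

lemma bij_betw_unindex_Basis: "bij_betw (unindex :: _ \<Rightarrow> real ^ 'n::finite) Basis Basis"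
  by (rule bij_betw_byWitness[where f' = reindex]) (auto simp: Basis_vec_def reindex_axis unindex_axis)

lemma measurable_unindex [measurable]: "unindex \<in> borel_measurable borel"
  by (simp add: borel_measurable_continuous_onI linear_continuous_on linear_linear linear_unindex)

lemma lborel_unindex: "distr lborel borel unindex = lborel"
  by (rule lborel_distr_basis_bij[OF linear_unindex bij_betw_unindex_Basis])

lemma has_derivative_reindex:
  assumes "(g has_derivative g') (at x within S)"
  shows "((\<lambda>y. reindex (g (unindex y))) has_derivative (\<lambda>v. reindex (g' (unindex v))))
    (at (reindex x) within reindex ` S)"
proof -
  have "(g has_derivative g') (at (unindex (reindex x)) within unindex ` reindex ` S)"
    using assms by (simp add: image_comp o_def)
  then have "((\<lambda>y. g (unindex y)) has_derivative (\<lambda>v. g' (unindex v))) (at (reindex x) within reindex ` S)"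
    by (intro has_derivative_in_compose[where f = unindex and g = g] linear_imp_has_derivative linear_unindex)
  then show ?thesis
    using bounded_linear.has_derivative[of reindex] linear_reindex linear_linear by blast
qed

lemma det_matrix_reindex:
  fixes L :: "real ^ 'n::finite \<Rightarrow> real ^ 'n"
  shows "det (matrix (\<lambda>v. reindex (L (unindex v)))) = det (matrix L)"
proof -
  have "matrix (\<lambda>v. reindex (L (unindex v))) = (\<chi> i j. matrix L $ of_enumerated i $ of_enumerated j)"
    by (simp add: matrix_def unindex_axis vec_eq_iff) (simp add: reindex_def)
  then show ?thesis
    by (simp add: det_reindex bij_of_enumerated)
qed

section \<open>The area formula for injective maps\<close>

text \<open>\<open>has_measure_differentiable_image\<close> is an equivalence between the image
  having a given finite measure and the Jacobian having that integral. One direction gives the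
  formula for finite measure; the other shows that the integral is infinite whenever the measure
  is.\<close>

lemma emeasure_differentiable_image:
  fixes g :: "real ^ 'n::{finite,wellorder} \<Rightarrow> real ^ 'n::_"
  assumes S: "S \<in> sets lebesgue"
    and der: "\<And>x. x \<in> S \<Longrightarrow> (g has_derivative g' x) (at x within S)"
    and inj: "inj_on g S"
  shows "g ` S \<in> sets lebesgue"
    and "(\<lambda>x. \<bar>det (matrix (g' x))\<bar> * indicator S x) \<in> borel_measurable lebesgue"
    and "emeasure lebesgue (g ` S) = (\<integral>\<^sup>+x. ennreal (\<bar>det (matrix (g' x))\<bar> * indicator S x) \<partial>lebesgue)"
proof -
  let ?h = "\<lambda>x. \<bar>det (matrix (g' x))\<bar> * indicator S x"
  show im: "g ` S \<in> sets lebesgue"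
    by (rule differentiable_image_in_sets_lebesgue[OF S])
       (use der in \<open>auto simp: differentiable_on_def differentiable_def\<close>)
  have "(\<lambda>x. \<bar>det (matrix (g' x))\<bar>) \<in> borel_measurable (lebesgue_on S)"
    using borel_measurable_det_Jacobian[OF S der] by measurable
  then show meas: "?h \<in> borel_measurable lebesgue"
    using S by (simp add: borel_measurable_restrict_space_iff mult.commute)
  show "emeasure lebesgue (g ` S) = (\<integral>\<^sup>+x. ennreal (?h x) \<partial>lebesgue)"
  proof (cases "g ` S \<in> lmeasurable")
    case True
    then have "((\<lambda>x. \<bar>det (matrix (g' x))\<bar>) has_integral measure lebesgue (g ` S)) S"
      using has_measure_differentiable_image[OF S der inj] by blast
    then have "(\<integral>\<^sup>+x. ennreal (\<bar>det (matrix (g' x))\<bar>) * indicator S x \<partial>lborel) = measure lebesgue (g ` S)"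
      by (intro nn_integral_has_integral_lebesgue') auto
    then show ?thesis
      using True by (simp add: nn_integral_completion emeasure_eq_measure2 ennreal_mult ennreal_indicator)
  next
    case False
    have "(\<integral>\<^sup>+x. ennreal (?h x) \<partial>lebesgue) = \<infinity>"
    proof (rule ccontr)
      assume "(\<integral>\<^sup>+x. ennreal (?h x) \<partial>lebesgue) \<noteq> \<infinity>"
      then obtain r where "r \<ge> 0" "(\<integral>\<^sup>+x. ennreal (?h x) \<partial>lebesgue) = ennreal r"
        by (cases "\<integral>\<^sup>+x. ennreal (?h x) \<partial>lebesgue" rule: ennreal_cases) simp_all
      then have "(?h has_integral r) UNIV"
        using meas by (subst has_integral_iff_nn_integral_lebesgue) auto
      then have "((\<lambda>x. if x \<in> S then \<bar>det (matrix (g' x))\<bar> else 0) has_integral r) UNIV"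
        by (rule has_integral_eq[rotated]) auto
      then have "((\<lambda>x. \<bar>det (matrix (g' x))\<bar>) has_integral r) S"
        by (simp add: has_integral_restrict_UNIV)
      then show False
        using has_measure_differentiable_image[OF S der inj] False by blast
    qed
    moreover have "emeasure lebesgue (g ` S) = \<infinity>"
      unfolding infinity_ennreal_def
      by (rule ccontr) (metis False fmeasurableI[OF im] infinity_ennreal_def top.not_eq_extremum)
    ultimately show ?thesis by simp
  qed
qed


text \<open>The area formula on the subsets of \<open>S\<close> cut out by Borel sets of values says
  that the measure with density \<open>J\<close>, pushed forward by \<open>g\<close>, is Lebesgue
  measure on the image. Integrating \<open>f\<close> against both gives the claim.\<close>

lemma nn_integral_change_of_variables_wellorder:
  fixes g :: "real ^ 'n::{finite,wellorder} \<Rightarrow> real ^ 'n::_" and f :: "real ^ 'n::_ \<Rightarrow> ennreal"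
  assumes S: "S \<in> sets lebesgue"
    and der: "\<And>x. x \<in> S \<Longrightarrow> (g has_derivative g' x) (at x within S)"
    and inj: "inj_on g S"
    and f [measurable]: "f \<in> borel_measurable borel"
  shows "(\<integral>\<^sup>+y\<in>g ` S. f y \<partial>lborel) = (\<integral>\<^sup>+x\<in>S. ennreal \<bar>det (matrix (g' x))\<bar> * f (g x) \<partial>lborel)"
proof -
  define J where "J x = ennreal (\<bar>det (matrix (g' x))\<bar> * indicator S x)" for x
  \<comment> \<open>\<open>g\<close> is extended by 0 to a total measurable map; \<open>J\<close>
    vanishes outside \<open>S\<close>, so no mass from there reaches the default value.\<close>
  define h where "h x = (if x \<in> S then g x else 0)" for x
  note meas = emeasure_differentiable_image[OF S der inj]
  have "continuous_on S g"
    using has_derivative_continuous[OF der] by (simp add: continuous_on_eq_continuous_within)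
  then have "g \<in> borel_measurable (lebesgue_on S)"
    by (rule continuous_imp_measurable_on_sets_lebesgue[OF _ S])
  then have [measurable]: "h \<in> borel_measurable lebesgue"
    using borel_measurable_if[OF S] unfolding h_def by blast
  have [measurable]: "J \<in> borel_measurable lebesgue"
    using measurable_compose[OF meas(2) measurable_ennreal] by (simp add: J_def[abs_def])
  have im [measurable]: "g ` S \<in> sets lebesgue"
    using der by (intro emeasure_differentiable_image(1)[OF S _ inj])
  have fm [measurable]: "f \<in> borel_measurable lebesgue"
    using measurable_completion[of f lborel borel] by simp
  have id: "(\<lambda>x. x) \<in> measurable lebesgue borel"
    by (rule measurable_completion) simp
  let ?N1 = "distr (density lebesgue (indicator (g ` S))) borel (\<lambda>x. x)"
  let ?N2 = "distr (density lebesgue J) borel h"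
  have "?N1 = ?N2"
  proof (rule measure_eqI)
    fix B assume "B \<in> sets ?N1"
    then have B [measurable]: "B \<in> sets borel" by simp
    have SB: "S \<inter> h -` B \<in> sets lebesgue"
      using S measurable_sets[OF \<open>h \<in> borel_measurable lebesgue\<close> B] by auto
    have "emeasure ?N1 B = emeasure lebesgue (g ` S \<inter> B)"
    proof -
      have "emeasure ?N1 B = emeasure (density lebesgue (indicator (g ` S))) B"
        using B id by (subst emeasure_distr) auto
      also have "\<dots> = (\<integral>\<^sup>+x. indicator (g ` S) x * indicator B x \<partial>lebesgue)"
        using B by (intro emeasure_density) (auto intro: borel_measurable_indicator im)
      also have "\<dots> = (\<integral>\<^sup>+x. indicator (g ` S \<inter> B) x \<partial>lebesgue)"
        by (simp add: indicator_inter_arith)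
      also have "\<dots> = emeasure lebesgue (g ` S \<inter> B)"
        using B by (intro nn_integral_indicator sets.Int im) simp
      finally show ?thesis .
    qed
    also have "g ` S \<inter> B = g ` (S \<inter> h -` B)"
      by (auto simp: h_def)
    also have "emeasure lebesgue (g ` (S \<inter> h -` B))
        = (\<integral>\<^sup>+x. ennreal (\<bar>det (matrix (g' x))\<bar> * indicator (S \<inter> h -` B) x) \<partial>lebesgue)"
      using der inj by (intro emeasure_differentiable_image(3)[OF SB])
        (auto intro: has_derivative_subset inj_on_subset)
    also have "\<dots> = (\<integral>\<^sup>+x. J x * indicator (h -` B) x \<partial>lebesgue)"
      by (rule nn_integral_cong) (auto simp: J_def indicator_def)
    also have "\<dots> = emeasure ?N2 B"
      using measurable_sets[OF \<open>h \<in> borel_measurable lebesgue\<close> B]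
      by (simp add: emeasure_distr emeasure_density)
    finally show "emeasure ?N1 B = emeasure ?N2 B" .
  qed simp
  moreover have "(\<integral>\<^sup>+y. f y \<partial>?N1) = (\<integral>\<^sup>+y. f y * indicator (g ` S) y \<partial>lebesgue)"
    using id im fm f by (subst nn_integral_distr) (auto simp: nn_integral_density mult.commute)
  moreover have "(\<integral>\<^sup>+y. f y \<partial>?N2) = (\<integral>\<^sup>+x. J x * f (h x) \<partial>lebesgue)"
    by (simp add: nn_integral_distr nn_integral_density)
  moreover have "(\<integral>\<^sup>+x. J x * f (h x) \<partial>lebesgue)
      = (\<integral>\<^sup>+x. ennreal \<bar>det (matrix (g' x))\<bar> * f (g x) * indicator S x \<partial>lebesgue)"
    by (rule nn_integral_cong) (auto simp: J_def indicator_def h_def)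
  ultimately show ?thesis
    by (simp add: nn_integral_completion)
qed

text \<open>Borel measurability of the image and of the whole integrand allows both integrals to be
  transported along \<open>unindex\<close>. It is demanded of the product and not of
  \<open>g'\<close>, since derivatives within a set may be chosen pointwise, without any
  regularity.\<close>

theorem nn_integral_change_of_variables:
  fixes g :: "real ^ 'n::finite \<Rightarrow> real ^ 'n" and f :: "real ^ 'n \<Rightarrow> ennreal"
  assumes S: "S \<in> sets borel"
    and der: "\<And>x. x \<in> S \<Longrightarrow> (g has_derivative g' x) (at x within S)"
    and inj: "inj_on g S"
    and f [measurable]: "f \<in> borel_measurable borel"
    and im [measurable]: "g ` S \<in> sets borel"
    and J [measurable]: "(\<lambda>x. ennreal \<bar>det (matrix (g' x))\<bar> * f (g x) * indicator S x) \<in> borel_measurable borel"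
  shows "(\<integral>\<^sup>+y\<in>g ` S. f y \<partial>lborel) = (\<integral>\<^sup>+x\<in>S. ennreal \<bar>det (matrix (g' x))\<bar> * f (g x) \<partial>lborel)"
proof -
  let ?g = "\<lambda>y. reindex (g (unindex y))" and ?g' = "\<lambda>y v. reindex (g' (unindex y) (unindex v))"
  have rS: "reindex ` S = unindex -` S"
    by (auto simp: image_iff) (metis reindex_unindex)
  then have "reindex ` S \<in> sets borel"
    using measurable_sets[OF measurable_unindex S] by simp
  then have "(\<integral>\<^sup>+y\<in>?g ` reindex ` S. f (unindex y) \<partial>lborel)
      = (\<integral>\<^sup>+x\<in>reindex ` S. ennreal \<bar>det (matrix (?g' x))\<bar> * f (unindex (?g x)) \<partial>lborel)"
    using inj by (intro nn_integral_change_of_variables_wellorder)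
      (auto simp: inj_on_def inj_eq[OF inj_on_inverseI[where g = unindex]] intro!: has_derivative_reindex[OF der])
  also have "?g ` reindex ` S = unindex -` g ` S"
    by (auto simp: image_iff) (metis reindex_unindex)
  also have "(\<integral>\<^sup>+y\<in>unindex -` g ` S. f (unindex y) \<partial>lborel)
      = (\<integral>\<^sup>+y. f y * indicator (g ` S) y \<partial>distr lborel borel unindex)"
    by (subst nn_integral_distr) (measurable, simp add: indicator_def)
  also have "(\<integral>\<^sup>+x\<in>reindex ` S. ennreal \<bar>det (matrix (?g' x))\<bar> * f (unindex (?g x)) \<partial>lborel)
      = (\<integral>\<^sup>+x. ennreal \<bar>det (matrix (g' x))\<bar> * f (g x) * indicator S x \<partial>distr lborel borel unindex)"
    by (subst nn_integral_distr) (measurable, simp add: indicator_def rS det_matrix_reindex)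
  finally show ?thesis
    by (simp add: lborel_unindex)
qed

text \<open>If \<open>L \<noteq> 0\<close> is the difference of two derivatives of \<open>f\<close> at \<open>x\<close>, then \<open>L\<close> is a derivative of \<open>0\<close>
  within the set, and so is a functional \<open>a \<bullet> _\<close> with \<open>a \<noteq> 0\<close>. Hence the orthogonal projection along \<open>a\<close>
  is a derivative of the identity, and Sard's theorem applies to the identity.\<close>

lemma negligible_nonunique_derivative:
  fixes f :: "real ^ 'n::finite \<Rightarrow> 'b::euclidean_space"
  assumes D1: "\<And>x. x \<in> E \<Longrightarrow> (f has_derivative D1 x) (at x within E)"
    and D2: "\<And>x. x \<in> E \<Longrightarrow> (f has_derivative D2 x) (at x within E)"
  shows "negligible {x \<in> E. D1 x \<noteq> D2 x}"
proof -
  let ?N = "{x \<in> E. D1 x \<noteq> D2 x}"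
  have "\<exists>P. ((\<lambda>y. y) has_derivative P) (at x within ?N) \<and> \<not> inj P" if x: "x \<in> ?N" for x
  proof -
    have D: "((\<lambda>y. 0) has_derivative (\<lambda>v. D1 x v - D2 x v)) (at x within ?N)"
      using has_derivative_subset[OF has_derivative_diff[OF D1 D2], of x ?N] x by auto
    then have lin: "linear (\<lambda>v. D1 x v - D2 x v)"
      using has_derivative_linear by blast
    obtain u where u: "D1 x u - D2 x u \<noteq> 0"
      using x by auto
    \<comment> \<open>Testing the nonzero difference with its own value \<open>w\<close> turns it
      into a functional represented by \<open>a\<close>, which is nonzero because
      \<open>a \<bullet> u\<close> equals \<open>w \<bullet> w\<close>.\<close>
    define w where "w = D1 x u - D2 x u"
    define a where "a = adjoint (\<lambda>v. D1 x v - D2 x v) w"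
    have a: "a \<bullet> v = w \<bullet> (D1 x v - D2 x v)" for v
      unfolding a_def using adjoint_works[OF lin, of v w] by (simp add: inner_commute)
    have "a \<noteq> 0"
      using a[of u] u by (auto simp: w_def)
    define P where "P v = v - ((a \<bullet> v) * inverse (a \<bullet> a)) *\<^sub>R a" for v
    \<comment> \<open>The subtracted term is constantly 0 as a function but has a nonzero derivative
      within the set; hence the identity also has the derivative \<open>P\<close>.\<close>
    have "((\<lambda>y. y - ((w \<bullet> 0) * inverse (a \<bullet> a)) *\<^sub>R a) has_derivative
        (\<lambda>v. v - ((w \<bullet> (D1 x v - D2 x v)) * inverse (a \<bullet> a)) *\<^sub>R a)) (at x within ?N)"
      by (intro has_derivative_diff has_derivative_scaleR_left has_derivative_mult_left
          has_derivative_inner_right D has_derivative_ident)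
    then have "((\<lambda>y. y) has_derivative P) (at x within ?N)"
      by (simp add: P_def[abs_def] a[symmetric])
    moreover have "P a = 0" "P 0 = 0"
      using \<open>a \<noteq> 0\<close> by (simp_all add: P_def)
    then have "\<not> inj P"
      using \<open>a \<noteq> 0\<close> by (metis injD)
    ultimately show ?thesis by auto
  qed
  then have "\<exists>P. \<forall>x\<in>?N. ((\<lambda>y. y) has_derivative P x) (at x within ?N) \<and> \<not> inj (P x)"
    by (intro bchoice ballI)
  then obtain P where
    P: "\<And>x. x \<in> ?N \<Longrightarrow> ((\<lambda>y. y) has_derivative P x) (at x within ?N)" "\<And>x. x \<in> ?N \<Longrightarrow> \<not> inj (P x)"
    by blast
  \<comment> \<open>Conjugation with \<open>reindex\<close> keeps the derivative non-injective, so
    its matrix has deficient rank.\<close>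
  let ?P = "\<lambda>x v. reindex (P (unindex x) (unindex v))"
  have "negligible ((\<lambda>y. y) ` reindex ` ?N)"
  proof (rule baby_Sard)
    fix x assume "x \<in> reindex ` ?N"
    then obtain z where z: "z \<in> ?N" "x = reindex z" by blast
    show der: "((\<lambda>y. y) has_derivative ?P x) (at x within reindex ` ?N)"
      using has_derivative_reindex[OF P(1)[OF z(1)]] by (simp add: z(2))
    obtain u v where "P z u = P z v" "u \<noteq> v"
      using P(2)[OF z(1)] by (auto simp: inj_def)
    then have uv: "?P x (reindex u) = ?P x (reindex v)" "reindex u \<noteq> reindex v"
      by (simp_all add: z(2)) (metis unindex_reindex)
    have "(*v) (matrix (?P x)) = ?P x"
      using has_derivative_linear[OF der] by simp
    then have "\<not> inj ((*v) (matrix (?P x)))"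
      using uv by (metis (no_types, lifting) injD)
    then show "rank (matrix (?P x)) < CARD('n enumerated)"
      using less_rank_noninjective by blast
  qed simp
  then have "negligible (reindex ` ?N)"
    by simp
  then have "negligible (unindex ` reindex ` ?N)"
    using bij_betw_same_card[OF bij_of_enumerated[where 'a = 'n]]
    by (intro negligible_differentiable_image_negligible[OF _ _ linear_imp_differentiable_on[OF linear_unindex]]) simp_all
  then show ?thesis
    by (simp add: image_comp o_def)
qed

section \<open>Charts and their volume\<close>

text \<open>With a left inverse \<open>L\<close> of \<open>B\<close>, the derivative is
  \<open>L\<close> after \<open>A\<close>. Expanding \<open>\<psi>\<close> to first order recovers
  the increment of \<open>\<tau>\<close> from that of the composition, with an error relative to the
  increment of \<open>\<tau>\<close> itself. Continuity of \<open>\<tau>\<close> makes the expansion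
  available; a Lipschitz bound then makes the error relative to \<open>y - x\<close>.\<close>

lemma has_derivative_lift:
  fixes \<psi> :: "'b::euclidean_space \<Rightarrow> 'c::euclidean_space" and \<tau> :: "'a::euclidean_space \<Rightarrow> 'b"
  assumes \<psi>: "(\<psi> has_derivative B) (at (\<tau> x))" and B: "inj B"
    and A: "((\<lambda>y. \<psi> (\<tau> y)) has_derivative A) (at x within E)"
    and cont: "continuous (at x within E) \<tau>"
  shows "\<exists>T. (\<tau> has_derivative T) (at x within E)"
proof -
  obtain L where L: "linear L" "L \<circ> B = id"
    using linear_injective_left_inverse[OF has_derivative_linear[OF \<psi>] B] by blast
  then have LB: "L (B v) = v" for v
    by (metis comp_apply id_apply)
  obtain C where C: "C > 0" "\<And>v. norm (L v) \<le> norm v * C"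
    using bounded_linear.pos_bounded L(1) linear_linear by blast
  have LA: "((\<lambda>y. L (\<psi> (\<tau> y))) has_derivative (\<lambda>v. L (A v))) (at x within E)"
    using bounded_linear.has_derivative[OF _ A] L(1) linear_linear by blast
  then have bl: "bounded_linear (\<lambda>v. L (A v))"
    by (rule has_derivative_bounded_linear)
  obtain K where K: "K > 0" "\<And>v. norm (L (A v)) \<le> norm v * K"
    using bounded_linear.pos_bounded[OF bl] by blast
  have 1: "\<forall>\<^sub>F y in at x within E. norm (L (\<psi> (\<tau> y)) - L (\<psi> (\<tau> x)) - (\<tau> y - \<tau> x)) \<le> e * norm (\<tau> y - \<tau> x)"
    if "e > 0" for e
  proof -
    from \<psi> \<open>e > 0\<close> C(1) obtain d where d: "d > 0"
      "\<And>z. norm (z - \<tau> x) < d \<Longrightarrow> norm (\<psi> z - \<psi> (\<tau> x) - B (z - \<tau> x)) \<le> e / C * norm (z - \<tau> x)"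
      unfolding has_derivative_at_alt by (meson divide_pos_pos)
    have "\<forall>\<^sub>F y in at x within E. dist (\<tau> y) (\<tau> x) < d"
      using cont d(1) by (auto simp: continuous_within tendsto_iff)
    then show ?thesis
    proof eventually_elim
      case (elim y)
      have "norm (L (\<psi> (\<tau> y)) - L (\<psi> (\<tau> x)) - (\<tau> y - \<tau> x)) = norm (L (\<psi> (\<tau> y) - \<psi> (\<tau> x) - B (\<tau> y - \<tau> x)))"
        by (simp only: linear_diff[OF L(1)] LB)
      also have "\<dots> \<le> norm (\<psi> (\<tau> y) - \<psi> (\<tau> x) - B (\<tau> y - \<tau> x)) * C"
        by (rule C(2))
      also have "\<dots> \<le> e / C * norm (\<tau> y - \<tau> x) * C"
        using d(2)[of "\<tau> y"] elim C(1) by (intro mult_right_mono) (auto simp: dist_norm)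
      also have "\<dots> = e * norm (\<tau> y - \<tau> x)"
        using C(1) by simp
      finally show ?case .
    qed
  qed
  have 2: "\<forall>\<^sub>F y in at x within E.
      norm (L (\<psi> (\<tau> y)) - L (\<psi> (\<tau> x)) - L (A (y - x))) \<le> e * norm (y - x)" if "e > 0" for e
    using LA that unfolding has_derivative_within_alt2 by blast
  \<comment> \<open>With \<open>1/2\<close> in the first estimate, half of the increment is absorbed
    on the left; this produces the factor 2.\<close>
  have 3: "\<forall>\<^sub>F y in at x within E. norm (\<tau> y - \<tau> x) \<le> 2 * (K + 1) * norm (y - x)"
    using 1[of "1/2", simplified] 2[of 1, simplified]
  proof eventually_elim
    case (elim y)
    have "norm (\<tau> y - \<tau> x) \<le> norm (L (\<psi> (\<tau> y)) - L (\<psi> (\<tau> x)) - (\<tau> y - \<tau> x))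
        + norm (L (\<psi> (\<tau> y)) - L (\<psi> (\<tau> x)) - L (A (y - x))) + norm (L (A (y - x)))"
      by norm
    then show ?case
      using elim K(2)[of "y - x"] by (simp add: algebra_simps)
  qed
  have "\<forall>\<^sub>F y in at x within E. norm (\<tau> y - \<tau> x - L (A (y - x))) \<le> e * norm (y - x)" if "e > 0" for e
  proof -
    \<comment> \<open>Chosen so that \<open>e' * (2 * (K + 1))\<close> is
      \<open>e / 2\<close>.\<close>
    define e' where "e' = e / (4 * (K + 1))"
    have "e' > 0" using that K(1) by (simp add: e'_def)
    from 1[OF this] 2[OF half_gt_zero[OF that]] 3 show ?thesis
    proof eventually_elim
      case (elim y)
      have "norm (\<tau> y - \<tau> x - L (A (y - x)))
          \<le> norm (L (\<psi> (\<tau> y)) - L (\<psi> (\<tau> x)) - (\<tau> y - \<tau> x)) + norm (L (\<psi> (\<tau> y)) - L (\<psi> (\<tau> x)) - L (A (y - x)))"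
        by norm
      also have "\<dots> \<le> e' * (2 * (K + 1) * norm (y - x)) + e / 2 * norm (y - x)"
        using elim \<open>e' > 0\<close> that mult_left_mono[of "norm (\<tau> y - \<tau> x)" "2 * (K + 1) * norm (y - x)" e'] by linarith
      also have "\<dots> = e * norm (y - x)"
        using K(1) by (simp add: e'_def field_simps)
      finally show ?case .
    qed
  qed
  then have "(\<tau> has_derivative (\<lambda>v. L (A v))) (at x within E)"
    unfolding has_derivative_within_alt2 using bl by blast
  then show ?thesis by blast
qed

text \<open>Taking the image itself as the ambient set makes the openness clause trivial, so a chart
  does not refer to any surrounding submanifold.\<close>

definition chart :: "(real ^ 'm::finite) set \<Rightarrow> (real ^ 'm \<Rightarrow> real ^ 'n::finite) \<Rightarrow> bool" where
  "chart U \<phi> \<longleftrightarrow> local_parametrization (\<phi> ` U) U \<phi>"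

lemma local_parametrization_imp_chart: "local_parametrization M U \<phi> \<Longrightarrow> chart U \<phi>"
  unfolding chart_def local_parametrization_def by auto

lemma chart_open: "chart U \<phi> \<Longrightarrow> open U"
  unfolding chart_def local_parametrization_def by auto

lemma chart_borel: "chart U \<phi> \<Longrightarrow> U \<in> sets borel"
  by (simp add: chart_open)

lemma chart_has_derivative:
  assumes "chart U \<phi>" "x \<in> U"
  shows "(\<phi> has_derivative frechet_derivative \<phi> (at x)) (at x)"
proof -
  have "Ck_on (Suc 0) U \<phi>"
    using assms unfolding chart_def local_parametrization_def by auto
  then show ?thesis
    using assms(2) by (simp add: frechet_derivative_works)
qed

lemma chart_inj_derivative: "chart U \<phi> \<Longrightarrow> x \<in> U \<Longrightarrow> inj (frechet_derivative \<phi> (at x))"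
  unfolding chart_def local_parametrization_def by auto

lemma chart_continuous: "chart U \<phi> \<Longrightarrow> continuous_on U \<phi>"
  by (intro continuous_at_imp_continuous_on ballI has_derivative_continuous[OF chart_has_derivative])

lemma chart_continuous_derivative:
  assumes "chart U \<phi>"
  shows "continuous_on U (\<lambda>x. frechet_derivative \<phi> (at x) v)"
proof -
  have "Ck_on (Suc 0) U \<phi>"
    using assms unfolding chart_def local_parametrization_def by auto
  then show ?thesis by simp
qed

lemma chart_inverse:
  assumes "chart U \<phi>"
  shows "inj_on \<phi> U" and "continuous_on (\<phi> ` U) (inv_into U \<phi>)"
proof -
  obtain \<psi> where \<psi>: "homeomorphism U (\<phi> ` U) \<phi> \<psi>"
    using assms unfolding chart_def local_parametrization_def by blast
  then show inj: "inj_on \<phi> U"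
    by (intro inj_on_inverseI[where g = \<psi>]) (auto simp: homeomorphism_apply1)
  have "continuous_on (\<phi> ` U) \<psi>"
    using \<psi> by (simp add: homeomorphism_def)
  then show "continuous_on (\<phi> ` U) (inv_into U \<phi>)"
    by (rule continuous_on_eq) (use \<psi> inj in \<open>auto simp: homeomorphism_apply1\<close>)
qed

lemma chart_vimage:
  assumes "chart U \<phi>" "B \<in> sets borel"
  shows "U \<inter> \<phi> -` B \<in> sets borel"
proof -
  have "\<phi> \<in> borel_measurable (restrict_space borel U)"
    by (rule borel_measurable_continuous_on_restrict[OF chart_continuous[OF assms(1)]])
  from measurable_sets[OF this assms(2)] show ?thesis
    using chart_borel[OF assms(1)] by (simp add: sets_restrict_space_iff space_restrict_space Int_commute)
qed

text \<open>The open set \<open>U\<close> is a countable union of compact sets, so its image is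
  Borel; the image of \<open>E\<close> is then a preimage under the continuous inverse.\<close>

lemma chart_image:
  assumes "chart U \<phi>" "E \<in> sets borel" "E \<subseteq> U"
  shows "\<phi> ` E \<in> sets borel"
proof -
  obtain K where K: "\<And>n::nat. compact (K n)" "(\<Union>n. K n) = U" "\<And>n. K n \<subseteq> U"
    using open_Union_compact_subsets[OF chart_open[OF assms(1)]] by metis
  have "\<phi> ` K n \<in> sets borel" for n
    using K(1,3) by (intro borel_compact compact_continuous_image continuous_on_subset[OF chart_continuous[OF assms(1)]])
  then have "(\<Union>n. \<phi> ` K n) \<in> sets borel"
    by blast
  also have "(\<Union>n. \<phi> ` K n) = \<phi> ` U"
    using K(2) by blast
  finally have U: "\<phi> ` U \<in> sets borel" .
  have "inv_into U \<phi> \<in> borel_measurable (restrict_space borel (\<phi> ` U))"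
    by (rule borel_measurable_continuous_on_restrict[OF chart_inverse(2)[OF assms(1)]])
  from measurable_sets[OF this assms(2)] have "inv_into U \<phi> -` E \<inter> \<phi> ` U \<in> sets borel"
    using U by (simp add: sets_restrict_space_iff space_restrict_space)
  also have "inv_into U \<phi> -` E \<inter> \<phi> ` U = \<phi> ` E"
    using assms(3) chart_inverse(1)[OF assms(1)] by (auto simp: inv_into_f_f)
  finally show ?thesis .
qed

lemma chart_continuous_gram:
  assumes "chart U \<phi>"
  shows "continuous_on U (gram_density \<phi>)"
proof -
  have "continuous_on U (\<lambda>x. (transpose (matrix (frechet_derivative \<phi> (at x)))
      ** matrix (frechet_derivative \<phi> (at x))) $ i $ j)" for i j
    by (auto simp: matrix_matrix_mult_def transpose_def matrix_def
        intro!: continuous_intros chart_continuous_derivative[OF assms])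
  then show ?thesis
    unfolding gram_density_def Let_def det_def
    by (intro continuous_on_real_sqrt continuous_on_sum continuous_on_mult continuous_on_const continuous_on_prod)
qed

definition chart_density :: "(real ^ 'm::finite) set \<Rightarrow> (real ^ 'm \<Rightarrow> real ^ 'n::finite) \<Rightarrow> real ^ 'm \<Rightarrow> ennreal" where
  "chart_density U \<phi> x = ennreal (gram_density \<phi> x) * indicator U x"

lemma measurable_chart_density:
  assumes "chart U \<phi>"
  shows "chart_density U \<phi> \<in> borel_measurable borel"
proof -
  have "(\<lambda>x. ennreal (indicator U x *\<^sub>R gram_density \<phi> x)) \<in> borel_measurable borel"
    using borel_measurable_continuous_on_indicator[OF chart_borel[OF assms] chart_continuous_gram[OF assms]]
    by (intro measurable_compose[OF _ measurable_ennreal]) simp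
  also have "(\<lambda>x. ennreal (indicator U x *\<^sub>R gram_density \<phi> x)) = chart_density U \<phi>"
    by (auto simp: chart_density_def fun_eq_iff indicator_def)
  finally show ?thesis .
qed

text \<open>By multiplicativity of \<open>det\<close>, a change of parameters multiplies the Gram
  determinant by the square of its Jacobian.\<close>

lemma gram_density_compose:
  fixes \<phi> \<psi> :: "real ^ 'm::finite \<Rightarrow> real ^ 'n::finite"
  assumes "linear T" "linear (frechet_derivative \<psi> (at y))"
    and "frechet_derivative \<phi> (at x) = (\<lambda>v. frechet_derivative \<psi> (at y) (T v))"
  shows "gram_density \<phi> x = gram_density \<psi> y * \<bar>det (matrix T)\<bar>"
proof -
  let ?B = "matrix (frechet_derivative \<psi> (at y))"
  have D: "matrix (frechet_derivative \<phi> (at x)) = ?B ** matrix T"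
    unfolding assms(3) using matrix_compose[OF assms(1,2)] by (simp add: o_def)
  have "transpose (?B ** matrix T) ** (?B ** matrix T) = transpose (matrix T) ** (transpose ?B ** ?B) ** matrix T"
    by (simp add: matrix_transpose_mul matrix_mul_assoc)
  then have "det (transpose (?B ** matrix T) ** (?B ** matrix T)) = det (transpose ?B ** ?B) * (det (matrix T))\<^sup>2"
    by (simp add: det_mul power2_eq_square mult_ac)
  then show ?thesis
    unfolding gram_density_def Let_def D by (simp add: real_sqrt_mult)
qed

text \<open>The change of variables runs along \<open>\<tau>\<close> from \<open>E\<close> to
  \<open>F\<close>. As \<open>E\<close> may have empty interior, only derivatives within
  \<open>E\<close> are available: \<open>has_derivative_lift\<close> supplies them, and
  \<open>negligible_nonunique_derivative\<close> compares the two resulting derivatives of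
  \<open>\<phi>\<close>.\<close>

lemma chart_volume_consistent:
  fixes \<phi> \<psi> :: "real ^ 'm::finite \<Rightarrow> real ^ 'n::finite"
  assumes \<phi>: "chart U \<phi>" and \<psi>: "chart V \<psi>"
    and E: "E \<in> sets borel" "E \<subseteq> U" and F: "F \<in> sets borel" "F \<subseteq> V"
    and EF: "\<phi> ` E = \<psi> ` F"
  shows "(\<integral>\<^sup>+x\<in>E. ennreal (gram_density \<phi> x) \<partial>lborel) = (\<integral>\<^sup>+x\<in>F. ennreal (gram_density \<psi> x) \<partial>lborel)"
proof -
  define \<tau> where "\<tau> x = inv_into V \<psi> (\<phi> x)" for x
  let ?D\<phi> = "\<lambda>x. frechet_derivative \<phi> (at x)" and ?D\<psi> = "\<lambda>y. frechet_derivative \<psi> (at y)"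
  have \<tau>: "\<tau> x \<in> F" "\<psi> (\<tau> x) = \<phi> x" if "x \<in> E" for x
  proof -
    from that EF obtain y where "y \<in> F" "\<phi> x = \<psi> y" by blast
    then show "\<tau> x \<in> F" "\<psi> (\<tau> x) = \<phi> x"
      using F(2) chart_inverse(1)[OF \<psi>] by (auto simp: \<tau>_def inv_into_f_f)
  qed
  have inj: "inj_on \<tau> E"
    using \<tau>(2) E(2) chart_inverse(1)[OF \<phi>] by (metis inj_onI inj_on_subset inj_onD)
  have im: "\<tau> ` E = F"
  proof
    show "F \<subseteq> \<tau> ` E"
    proof
      fix y assume y: "y \<in> F"
      then obtain x where x: "x \<in> E" "\<psi> y = \<phi> x" using EF by blast
      then have "\<tau> x = y"
        using \<tau>[OF x(1)] y F(2) chart_inverse(1)[OF \<psi>] by (metis inj_onD subsetD)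
      then show "y \<in> \<tau> ` E" using x(1) by blast
    qed
  qed (use \<tau>(1) in auto)
  have cont: "continuous_on E \<tau>"
    unfolding \<tau>_def using E(2) F(2) EF
    by (intro continuous_on_compose2[OF chart_inverse(2)[OF \<psi>] continuous_on_subset[OF chart_continuous[OF \<phi>]]]) auto
  have "\<exists>T. (\<tau> has_derivative T) (at x within E)" if x: "x \<in> E" for x
  proof (rule has_derivative_lift)
    show "(\<psi> has_derivative ?D\<psi> (\<tau> x)) (at (\<tau> x))" "inj (?D\<psi> (\<tau> x))"
      using chart_has_derivative[OF \<psi>] chart_inj_derivative[OF \<psi>] \<tau>(1)[OF x] F(2) by auto
    have "(\<phi> has_derivative ?D\<phi> x) (at x within E)"
      using chart_has_derivative[OF \<phi>] x E(2) by (auto intro: has_derivative_at_withinI)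
    then show "((\<lambda>y. \<psi> (\<tau> y)) has_derivative ?D\<phi> x) (at x within E)"
      by (rule has_derivative_transform[rotated 2]) (use x \<tau>(2) in auto)
    show "continuous (at x within E) \<tau>"
      using cont x by (simp add: continuous_on_eq_continuous_within)
  qed
  then obtain T where T: "\<And>x. x \<in> E \<Longrightarrow> (\<tau> has_derivative T x) (at x within E)"
    by metis
  have "negligible {x \<in> E. ?D\<phi> x \<noteq> (\<lambda>v. ?D\<psi> (\<tau> x) (T x v))}"
  proof (rule negligible_nonunique_derivative)
    fix x assume x: "x \<in> E"
    show "(\<phi> has_derivative ?D\<phi> x) (at x within E)"
      using chart_has_derivative[OF \<phi>] x E(2) by (auto intro: has_derivative_at_withinI)
    have "(\<psi> has_derivative ?D\<psi> (\<tau> x)) (at (\<tau> x) within \<tau> ` E)"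
      using chart_has_derivative[OF \<psi>] \<tau>(1)[OF x] F(2) by (auto intro: has_derivative_at_withinI)
    then have "((\<lambda>y. \<psi> (\<tau> y)) has_derivative (\<lambda>v. ?D\<psi> (\<tau> x) (T x v))) (at x within E)"
      by (rule has_derivative_in_compose[OF T[OF x]])
    then show "(\<phi> has_derivative (\<lambda>v. ?D\<psi> (\<tau> x) (T x v))) (at x within E)"
      by (rule has_derivative_transform[rotated 2]) (use x \<tau>(2) in auto)
  qed
  then have "AE x in lebesgue. x \<notin> {x \<in> E. ?D\<phi> x \<noteq> (\<lambda>v. ?D\<psi> (\<tau> x) (T x v))}"
    by (intro AE_not_in) (simp add: negligible_iff_null_sets)
  then have "AE x in lborel. x \<notin> {x \<in> E. ?D\<phi> x \<noteq> (\<lambda>v. ?D\<psi> (\<tau> x) (T x v))}"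
    by (simp add: AE_completion_iff)
  \<comment> \<open>A Borel null set around the exceptional points keeps \<open>E'\<close>
    Borel.\<close>
  then obtain N where N: "N \<in> null_sets lborel"
    "\<And>x. x \<in> E - N \<Longrightarrow> ?D\<phi> x = (\<lambda>v. ?D\<psi> (\<tau> x) (T x v))"
    by (auto elim!: AE_E3)
  define E' where "E' = E - N"
  have E': "E' \<in> sets borel" "E' \<subseteq> E"
    using E(1) N(1) by (auto simp: E'_def)
  have F': "\<tau> ` E' \<in> sets borel"
  proof -
    \<comment> \<open>Borel measurability is read off from a preimage under \<open>\<psi>\<close> of
      a chart image, instead of the forward image under \<open>\<tau>\<close>.\<close>
    have "\<tau> ` E' = F \<inter> (V \<inter> \<psi> -` \<phi> ` E')"
    proof -
      have "y \<in> \<tau> ` E'" if y: "y \<in> F" "\<psi> y \<in> \<phi> ` E'" for y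
      proof -
        obtain x where x: "x \<in> E'" "\<psi> y = \<phi> x" using y by blast
        then have "\<tau> x = y"
          using \<tau>[of x] y F(2) E'(2) chart_inverse(1)[OF \<psi>] by (metis inj_onD subsetD)
        then show ?thesis using x by blast
      qed
      then show ?thesis using \<tau> E'(2) subsetD[OF F(2)] by (auto simp: subset_iff)
    qed
    also have "\<dots> \<in> sets borel"
      using F(1) E' E(2) by (intro sets.Int chart_vimage[OF \<psi>] chart_image[OF \<phi>]) auto
    finally show ?thesis .
  qed
  have gram: "gram_density \<phi> x = gram_density \<psi> (\<tau> x) * \<bar>det (matrix (T x))\<bar>" if "x \<in> E'" for x
  proof (rule gram_density_compose)
    have x: "x \<in> E" "x \<in> E - N"
      using that by (auto simp: E'_def)
    show "linear (T x)"
      by (rule has_derivative_linear[OF T[OF x(1)]])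
    show "linear (?D\<psi> (\<tau> x))"
      by (rule has_derivative_linear[OF chart_has_derivative[OF \<psi> subsetD[OF F(2) \<tau>(1)[OF x(1)]]]])
    show "?D\<phi> x = (\<lambda>v. ?D\<psi> (\<tau> x) (T x v))"
      by (rule N(2)[OF x(2)])
  qed
  \<comment> \<open>This identity also gives measurability: the left side contains the arbitrarily
    chosen \<open>T\<close>, the right side only \<open>\<phi>\<close> and
    \<open>E'\<close>.\<close>
  have J: "ennreal \<bar>det (matrix (T x))\<bar> * (chart_density V \<psi> (\<tau> x)) * indicator E' x
      = chart_density U \<phi> x * indicator E' x" for x
    using gram[of x] \<tau>(1)[of x] E'(2) E(2) F(2)
    by (auto simp: chart_density_def indicator_def ennreal_mult'' mult.commute)
  have "(\<integral>\<^sup>+x\<in>E. ennreal (gram_density \<phi> x) \<partial>lborel) = (\<integral>\<^sup>+x. chart_density U \<phi> x * indicator E' x \<partial>lborel)"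
  proof (rule nn_integral_cong_AE)
    show "AE x in lborel. ennreal (gram_density \<phi> x) * indicator E x = chart_density U \<phi> x * indicator E' x"
      using AE_not_in[OF N(1)] by eventually_elim (use E(2) in \<open>auto simp: chart_density_def E'_def indicator_def\<close>)
  qed
  also have "\<dots> = (\<integral>\<^sup>+x\<in>E'. ennreal \<bar>det (matrix (T x))\<bar> * chart_density V \<psi> (\<tau> x) \<partial>lborel)"
    by (simp only: J)
  also have "\<dots> = (\<integral>\<^sup>+y\<in>\<tau> ` E'. chart_density V \<psi> y \<partial>lborel)"
  proof (rule nn_integral_change_of_variables[symmetric])
    show "(\<tau> has_derivative T x) (at x within E')" if "x \<in> E'" for x
      using T E'(2) that by (auto intro: has_derivative_subset)
    show "(\<lambda>x. ennreal \<bar>det (matrix (T x))\<bar> * chart_density V \<psi> (\<tau> x) * indicator E' x) \<in> borel_measurable borel"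
      unfolding J using measurable_chart_density[OF \<phi>] E'(1) by measurable
  qed (use E' F' inj measurable_chart_density[OF \<psi>] in \<open>auto intro: inj_on_subset\<close>)
  also have "\<dots> = (\<integral>\<^sup>+y\<in>F. ennreal (gram_density \<psi> y) \<partial>lborel)"
  proof (rule nn_integral_cong_AE)
    \<comment> \<open>A differentiable map between spaces of equal dimension keeps null sets null,
      so discarding \<open>N\<close> costs only a null set of \<open>F\<close>.\<close>
    have "negligible (\<tau> ` (E \<inter> N))"
    proof (rule negligible_differentiable_image_negligible)
      show "\<tau> differentiable_on E \<inter> N"
        using T by (auto simp: differentiable_on_def differentiable_def intro: has_derivative_subset)
      show "negligible (E \<inter> N)"
        by (rule negligible_subset[of N]) (use N(1) in \<open>auto simp: negligible_iff_null_sets null_sets_completionI\<close>)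
    qed simp
    then have "AE y in lebesgue. y \<notin> \<tau> ` (E \<inter> N)"
      by (simp add: negligible_iff_null_sets AE_not_in)
    then have "AE y in lborel. y \<notin> \<tau> ` (E \<inter> N)"
      by (simp add: AE_completion_iff)
    then show "AE y in lborel. chart_density V \<psi> y * indicator (\<tau> ` E') y = ennreal (gram_density \<psi> y) * indicator F y"
    proof eventually_elim
      case (elim y)
      then have "y \<in> \<tau> ` E' \<longleftrightarrow> y \<in> F"
        using im by (auto simp: E'_def)
      then show ?case
        using F(2) by (auto simp: chart_density_def indicator_def)
    qed
  qed
  finally show ?thesis .
qed

text \<open>\<open>indicator U x *\<^sub>R \<phi> x\<close> is a Borel representative of
  \<open>\<phi>\<close>; points outside \<open>U\<close> go to 0 but carry density 0.\<close>

definition chart_measure :: "(real ^ 'm::finite) set \<Rightarrow> (real ^ 'm \<Rightarrow> real ^ 'n::finite) \<Rightarrow> (real ^ 'n) measure" where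
  "chart_measure U \<phi> = distr (density lborel (chart_density U \<phi>)) borel (\<lambda>x. indicator U x *\<^sub>R \<phi> x)"

lemma sets_chart_measure [simp, measurable_cong]: "sets (chart_measure U \<phi>) = sets borel"
  by (simp add: chart_measure_def)

lemma measurable_chart_map: "chart U \<phi> \<Longrightarrow> (\<lambda>x. indicator U x *\<^sub>R \<phi> x) \<in> borel_measurable borel"
  by (rule borel_measurable_continuous_on_indicator[OF chart_borel chart_continuous])

lemma nn_integral_chart_measure:
  assumes \<phi>: "chart U \<phi>" and [measurable]: "g \<in> borel_measurable borel"
  shows "(\<integral>\<^sup>+y. g y \<partial>chart_measure U \<phi>) = (\<integral>\<^sup>+x\<in>U. ennreal (gram_density \<phi> x) * g (\<phi> x) \<partial>lborel)"
proof -
  note [measurable] = measurable_chart_map[OF \<phi>] measurable_chart_density[OF \<phi>]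
  have "(\<integral>\<^sup>+y. g y \<partial>chart_measure U \<phi>) = (\<integral>\<^sup>+x. chart_density U \<phi> x * g (indicator U x *\<^sub>R \<phi> x) \<partial>lborel)"
    unfolding chart_measure_def by (simp add: nn_integral_distr nn_integral_density)
  also have "\<dots> = (\<integral>\<^sup>+x\<in>U. ennreal (gram_density \<phi> x) * g (\<phi> x) \<partial>lborel)"
    by (rule nn_integral_cong) (auto simp: chart_density_def indicator_def)
  finally show ?thesis .
qed

lemma emeasure_chart_measure:
  assumes \<phi>: "chart U \<phi>" and A: "A \<in> sets borel"
  shows "emeasure (chart_measure U \<phi>) A = (\<integral>\<^sup>+x\<in>U \<inter> \<phi> -` A. ennreal (gram_density \<phi> x) \<partial>lborel)"
proof -
  have "emeasure (chart_measure U \<phi>) A = (\<integral>\<^sup>+y. indicator A y \<partial>chart_measure U \<phi>)"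
    using A by simp
  also have "\<dots> = (\<integral>\<^sup>+x\<in>U. ennreal (gram_density \<phi> x) * indicator A (\<phi> x) \<partial>lborel)"
    using A by (intro nn_integral_chart_measure[OF \<phi>]) simp
  also have "\<dots> = (\<integral>\<^sup>+x\<in>U \<inter> \<phi> -` A. ennreal (gram_density \<phi> x) \<partial>lborel)"
    by (rule nn_integral_cong) (auto simp: indicator_def)
  finally show ?thesis .
qed

lemma emeasure_chart_measure_image:
  assumes \<phi>: "chart U \<phi>" and E: "E \<in> sets borel" "E \<subseteq> U"
  shows "emeasure (chart_measure U \<phi>) (\<phi> ` E) = (\<integral>\<^sup>+x\<in>E. ennreal (gram_density \<phi> x) \<partial>lborel)"
proof -
  have "U \<inter> \<phi> -` \<phi> ` E = E"
    using E(2) chart_inverse(1)[OF \<phi>] by (auto dest: inj_onD)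
  then show ?thesis
    by (simp add: emeasure_chart_measure[OF \<phi> chart_image[OF \<phi> E]])
qed

lemma chart_image_vimage: "A \<subseteq> \<phi> ` U \<Longrightarrow> A = \<phi> ` (U \<inter> \<phi> -` A)"
  by auto

lemma chart_measure_consistent:
  fixes \<phi> \<psi> :: "real ^ 'm::finite \<Rightarrow> real ^ 'n::finite"
  assumes \<phi>: "chart U \<phi>" and \<psi>: "chart V \<psi>"
    and A: "A \<in> sets borel" "A \<subseteq> \<phi> ` U" "A \<subseteq> \<psi> ` V"
  shows "emeasure (chart_measure U \<phi>) A = emeasure (chart_measure V \<psi>) A"
  unfolding emeasure_chart_measure[OF \<phi> A(1)] emeasure_chart_measure[OF \<psi> A(1)]
  by (rule chart_volume_consistent[OF \<phi> \<psi>])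
     (use A chart_vimage[OF \<phi> A(1)] chart_vimage[OF \<psi> A(1)] in auto)

section \<open>Gluing charts\<close>

text \<open>Inclusion instead of equality lets a cover serve all subsets of \<open>M\<close>. The
  charts need not come from a common submanifold.\<close>

definition chart_cover ::
    "(nat \<Rightarrow> (real ^ 'm::finite) set) \<Rightarrow> (nat \<Rightarrow> real ^ 'm \<Rightarrow> real ^ 'n::finite) \<Rightarrow> (real ^ 'n) set \<Rightarrow> bool" where
  "chart_cover U \<phi> M \<longleftrightarrow> (\<forall>k. chart (U k) (\<phi> k)) \<and> M \<subseteq> (\<Union>k. \<phi> k ` U k)"

lemma chart_cover_subset: "chart_cover U \<phi> M \<Longrightarrow> N \<subseteq> M \<Longrightarrow> chart_cover U \<phi> N"
  unfolding chart_cover_def by auto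

text \<open>Each point is counted by the first chart whose image contains it;
  \<open>disjointed\<close> removes the earlier images.\<close>

definition glued_measure ::
    "(nat \<Rightarrow> (real ^ 'm::finite) set) \<Rightarrow> (nat \<Rightarrow> real ^ 'm \<Rightarrow> real ^ 'n::finite) \<Rightarrow> (real ^ 'n) measure" where
  "glued_measure U \<phi> = measure_of UNIV (sets borel)
     (\<lambda>A. \<Sum>k. emeasure (chart_measure (U k) (\<phi> k)) (A \<inter> disjointed (\<lambda>k. \<phi> k ` U k) k))"

lemma sets_glued_measure [simp, measurable_cong]: "sets (glued_measure U \<phi>) = sets borel"
  unfolding glued_measure_def by (rule sets.sets_measure_of_eq[of borel, unfolded space_borel])

lemma disjointed_chart_images:
  assumes "\<And>k. chart (U k) (\<phi> k)"
  shows "disjointed (\<lambda>k. \<phi> k ` U k) k \<in> sets borel"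
proof -
  have "range (\<lambda>k. \<phi> k ` U k) \<subseteq> sets borel"
    using chart_image[OF assms chart_borel[OF assms]] by auto
  from sets.range_disjointed_sets[OF this] show ?thesis by blast
qed

lemma suminf_ennreal_swap:
  fixes f :: "nat \<Rightarrow> nat \<Rightarrow> ennreal"
  shows "(\<Sum>i. \<Sum>j. f i j) = (\<Sum>j. \<Sum>i. f i j)"
proof -
  have "(\<Sum>i. \<Sum>j. f i j) = (\<Sum>i. \<integral>\<^sup>+j. f i j \<partial>count_space UNIV)"
    by (simp add: nn_integral_count_space_nat)
  also have "\<dots> = (\<integral>\<^sup>+j. (\<Sum>i. f i j) \<partial>count_space UNIV)"
    by (rule nn_integral_suminf[symmetric]) simp
  finally show ?thesis
    by (simp add: nn_integral_count_space_nat)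
qed

lemma emeasure_glued_measure:
  assumes chart: "\<And>k. chart (U k) (\<phi> k)" and A: "A \<in> sets borel"
  shows "emeasure (glued_measure U \<phi>) A
    = (\<Sum>k. emeasure (chart_measure (U k) (\<phi> k)) (A \<inter> disjointed (\<lambda>k. \<phi> k ` U k) k))"
proof (rule emeasure_measure_of[OF glued_measure_def])
  let ?D = "disjointed (\<lambda>k. \<phi> k ` U k)" and ?M = "\<lambda>k. chart_measure (U k) (\<phi> k)"
  show "countably_additive (sets (glued_measure U \<phi>)) (\<lambda>A. \<Sum>k. emeasure (?M k) (A \<inter> ?D k))"
  proof (rule countably_additiveI)
    fix B :: "nat \<Rightarrow> (real ^ 'b) set"
    assume B: "range B \<subseteq> sets (glued_measure U \<phi>)" "disjoint_family B"
    have "(\<Sum>i. \<Sum>k. emeasure (?M k) (B i \<inter> ?D k)) = (\<Sum>k. \<Sum>i. emeasure (?M k) (B i \<inter> ?D k))"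
      by (rule suminf_ennreal_swap)
    also have "\<dots> = (\<Sum>k. emeasure (?M k) ((\<Union>i. B i) \<inter> ?D k))"
    proof (rule suminf_cong)
      fix k
      have "(\<Sum>i. emeasure (?M k) (B i \<inter> ?D k)) = emeasure (?M k) (\<Union>i. B i \<inter> ?D k)"
        using B disjointed_chart_images[OF chart]
        by (intro suminf_emeasure) (auto simp: disjoint_family_on_def)
      moreover have "(\<Union>i. B i \<inter> ?D k) = (\<Union>i. B i) \<inter> ?D k"
        by blast
      ultimately show "(\<Sum>i. emeasure (?M k) (B i \<inter> ?D k)) = emeasure (?M k) ((\<Union>i. B i) \<inter> ?D k)"
        by (simp only:)
    qed
    finally show "(\<Sum>i. \<Sum>k. emeasure (?M k) (B i \<inter> ?D k)) = (\<Sum>k. emeasure (?M k) ((\<Union>i. B i) \<inter> ?D k))" .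
  qed
qed (use A in \<open>auto simp: positive_def sets_eq_imp_space_eq[of "glued_measure U \<phi>" borel]\<close>)

text \<open>\<open>A\<close> is cut along the disjointed images; each part lies in two charts, and
  \<open>chart_measure_consistent\<close> replaces the one of the cover by
  \<open>\<psi>\<close>.\<close>

lemma emeasure_glued_measure_chart:
  fixes U :: "nat \<Rightarrow> (real ^ 'm::finite) set" and V :: "(real ^ 'm) set"
  assumes cover: "chart_cover U \<phi> A" and \<psi>: "chart V \<psi>"
    and A: "A \<in> sets borel" "A \<subseteq> \<psi> ` V"
  shows "emeasure (glued_measure U \<phi>) A = emeasure (chart_measure V \<psi>) A"
proof -
  have chart: "chart (U k) (\<phi> k)" for k
    using cover by (simp add: chart_cover_def)
  let ?D = "disjointed (\<lambda>k. \<phi> k ` U k)"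
  have AD: "A \<inter> ?D k \<in> sets borel" for k
    using A(1) disjointed_chart_images[OF chart] by auto
  have "emeasure (glued_measure U \<phi>) A = (\<Sum>k. emeasure (chart_measure (U k) (\<phi> k)) (A \<inter> ?D k))"
    by (rule emeasure_glued_measure[OF chart A(1)])
  also have "\<dots> = (\<Sum>k. emeasure (chart_measure V \<psi>) (A \<inter> ?D k))"
    using A(2) disjointed_subset[of "\<lambda>k. \<phi> k ` U k"] AD
    by (intro suminf_cong chart_measure_consistent[OF chart \<psi>]) auto
  also have "\<dots> = emeasure (chart_measure V \<psi>) (\<Union>k. A \<inter> ?D k)"
    using AD disjoint_family_disjointed[of "\<lambda>k. \<phi> k ` U k"]
    by (intro suminf_emeasure) (auto simp: disjoint_family_on_def)
  also have "(\<Union>k. A \<inter> ?D k) = A"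
    using cover UN_disjointed_eq[of "\<lambda>k. \<phi> k ` U k"] unfolding chart_cover_def by blast
  finally show ?thesis .
qed

text \<open>Cutting along the second cover puts each part inside one chart, where
  \<open>emeasure_glued_measure_chart\<close> evaluates the first glued measure.\<close>

lemma emeasure_glued_measure_unique:
  fixes U V :: "nat \<Rightarrow> (real ^ 'm::finite) set"
  assumes U: "chart_cover U \<phi> A" and V: "chart_cover V \<psi> A" and A: "A \<in> sets borel"
  shows "emeasure (glued_measure U \<phi>) A = emeasure (glued_measure V \<psi>) A"
proof -
  have chart: "chart (V k) (\<psi> k)" for k
    using V by (simp add: chart_cover_def)
  let ?D = "disjointed (\<lambda>k. \<psi> k ` V k)"
  have AD: "A \<inter> ?D k \<in> sets borel" for k
    using A(1) disjointed_chart_images[OF chart] by auto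
  have "emeasure (glued_measure V \<psi>) A = (\<Sum>k. emeasure (chart_measure (V k) (\<psi> k)) (A \<inter> ?D k))"
    by (rule emeasure_glued_measure[OF chart A(1)])
  also have "\<dots> = (\<Sum>k. emeasure (glued_measure U \<phi>) (A \<inter> ?D k))"
    using disjointed_subset[of "\<lambda>k. \<psi> k ` V k"] AD
    by (intro suminf_cong emeasure_glued_measure_chart[symmetric] chart chart_cover_subset[OF U]) auto
  also have "\<dots> = emeasure (glued_measure U \<phi>) (\<Union>k. A \<inter> ?D k)"
    using AD disjoint_family_disjointed[of "\<lambda>k. \<psi> k ` V k"]
    by (intro suminf_emeasure) (auto simp: disjoint_family_on_def)
  also have "(\<Union>k. A \<inter> ?D k) = A"
    using V UN_disjointed_eq[of "\<lambda>k. \<psi> k ` V k"] unfolding chart_cover_def by blast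
  finally show ?thesis by simp
qed

lemma local_parametrization_empty: "local_parametrization M {} \<phi>"
  unfolding local_parametrization_def by (auto simp: homeomorphism_def)

lemma local_parametrization_subset: "local_parametrization M U \<phi> \<Longrightarrow> \<phi> ` U \<subseteq> M"
  unfolding local_parametrization_def using openin_imp_subset by blast

section \<open>Countable chart covers of submanifolds\<close>

text \<open>The padding value \<open>d\<close> handles finite and empty families; for charts it is
  the one with empty domain.\<close>

lemma countable_enumeration:
  assumes "countable \<C>" "\<And>c. c \<in> \<C> \<Longrightarrow> P c" "P d"
  shows "\<exists>c :: nat \<Rightarrow> 'a. (\<forall>k. P (c k)) \<and> \<C> \<subseteq> range c"
proof (intro exI conjI allI)
  show "P (from_nat_into (insert d \<C>) k)" for k
    using from_nat_into[of "insert d \<C>" k] assms(2,3) by auto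
  show "\<C> \<subseteq> range (from_nat_into (insert d \<C>))"
    using range_from_nat_into[of "insert d \<C>"] assms(1) by auto
qed

lemma submanifold_cover:
  assumes "submanifold TYPE('m::finite) (S :: (real ^ 'n::finite) set)"
  obtains U :: "nat \<Rightarrow> (real ^ 'm) set" and \<phi> where
    "\<And>k. local_parametrization S (U k) (\<phi> k)" "S = (\<Union>k. \<phi> k ` U k)"
proof -
  obtain U :: "real ^ 'n \<Rightarrow> (real ^ 'm) set" and \<phi> where
    lp: "\<And>p. p \<in> S \<Longrightarrow> local_parametrization S (U p) (\<phi> p)" "\<And>p. p \<in> S \<Longrightarrow> p \<in> \<phi> p ` U p"
    using assms unfolding submanifold_def by metis
  have op: "openin (top_of_set S) T" if "T \<in> (\<lambda>p. \<phi> p ` U p) ` S" for T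
    using that lp(1) by (auto simp: local_parametrization_def)
  obtain \<F> where \<F>: "\<F> \<subseteq> (\<lambda>p. \<phi> p ` U p) ` S" "countable \<F>" "\<Union>\<F> = (\<Union>p\<in>S. \<phi> p ` U p)"
    by (rule Lindelof_openin[OF op])
  then obtain Q where Q: "countable Q" "Q \<subseteq> S" "\<F> = (\<lambda>p. \<phi> p ` U p) ` Q"
    using countable_subset_image[of \<F> "\<lambda>p. \<phi> p ` U p" S] by auto
  have sub: "\<phi> p ` U p \<subseteq> S" if "p \<in> S" for p
    using lp(1)[OF that] by (rule local_parametrization_subset)
  have "\<exists>c :: nat \<Rightarrow> _. (\<forall>k. local_parametrization S (fst (c k)) (snd (c k))) \<and> (\<lambda>p. (U p, \<phi> p)) ` Q \<subseteq> range c"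
    by (rule countable_enumeration[where d = "({}, undefined)"
          and P = "\<lambda>c. local_parametrization S (fst c) (snd c)"])
       (use Q lp(1) local_parametrization_empty in auto)
  then obtain c :: "nat \<Rightarrow> _" where c: "\<And>k. local_parametrization S (fst (c k)) (snd (c k))"
    "(\<lambda>p. (U p, \<phi> p)) ` Q \<subseteq> range c"
    by (elim exE conjE) auto
  have "S \<subseteq> (\<Union>k. snd (c k) ` fst (c k))"
  proof
    fix p assume "p \<in> S"
    then have "p \<in> (\<Union>p\<in>S. \<phi> p ` U p)"
      using lp(2) by blast
    then have "p \<in> (\<Union>q\<in>Q. \<phi> q ` U q)"
      using \<F>(3) Q(3) by simp
    then obtain q where q: "q \<in> Q" "p \<in> \<phi> q ` U q"
      by (rule UN_E)
    then obtain k where "c k = (U q, \<phi> q)"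
      using c(2) by (metis (no_types, lifting) image_eqI image_iff subsetD)
    then show "p \<in> (\<Union>k. snd (c k) ` fst (c k))"
      using q(2) by (intro UN_I[of k]) simp_all
  qed
  moreover have "snd (c k) ` fst (c k) \<subseteq> S" for k
    using c(1) by (rule local_parametrization_subset)
  ultimately show thesis
    using that[of "\<lambda>k. fst (c k)" "\<lambda>k. snd (c k)"] c(1) by blast
qed

text \<open>The definite description in \<open>volume_measure\<close> is resolved by the glued
  measure of a countable cover of \<open>S\<close>: existence by independence of the charts,
  uniqueness because every Borel subset splits into parts inside single charts. The value then
  passes to any cover of \<open>A\<close>, whose charts need not parametrize
  \<open>S\<close>.\<close>

lemma emeasure_volume_measure:
  fixes U :: "nat \<Rightarrow> (real ^ 'm::finite) set" and \<phi> :: "nat \<Rightarrow> real ^ 'm \<Rightarrow> real ^ 'n::finite"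
  assumes S: "submanifold TYPE('m) S" and A: "A \<in> sets borel" "A \<subseteq> S"
    and cover: "chart_cover U \<phi> A"
  shows "emeasure (volume_measure TYPE('m) S) A = emeasure (glued_measure U \<phi>) A"
proof -
  obtain V :: "nat \<Rightarrow> (real ^ 'm) set" and \<psi> where
    V: "\<And>k. local_parametrization S (V k) (\<psi> k)" "S = (\<Union>k. \<psi> k ` V k)"
    using submanifold_cover[OF S] by metis
  have chart: "chart (V k) (\<psi> k)" for k
    using V(1) by (rule local_parametrization_imp_chart)
  have V_cover: "chart_cover V \<psi> S"
    using chart V(2) by (auto simp: chart_cover_def)
  have S_borel: "S \<in> sets borel"
    unfolding V(2) using chart_image[OF chart chart_borel[OF chart]] by auto
  let ?G = "restrict_space (glued_measure V \<psi>) S"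
  have space_glued [simp]: "space (glued_measure V \<psi>) = UNIV"
    using sets_eq_imp_space_eq[OF sets_glued_measure] by auto
  have emeasure_G: "emeasure ?G B = emeasure (glued_measure V \<psi>) B" if "B \<subseteq> S" for B
    using S_borel that by (intro emeasure_restrict_space) auto
  have "is_volume_measure TYPE('m) S ?G"
    unfolding is_volume_measure_def
  proof (intro conjI allI impI)
    show "sets ?G = sets (restrict_space borel S)"
      by (simp add: sets_restrict_space)
    fix W :: "(real ^ 'm) set" and \<theta> E
    assume W: "local_parametrization S W \<theta>" "E \<in> sets borel" "E \<subseteq> W"
    have \<theta>: "chart W \<theta>"
      using W(1) by (rule local_parametrization_imp_chart)
    have sub: "\<theta> ` E \<subseteq> S"
      using local_parametrization_subset[OF W(1)] W(3) by blast
    have "emeasure ?G (\<theta> ` E) = emeasure (chart_measure W \<theta>) (\<theta> ` E)"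
      unfolding emeasure_G[OF sub]
      by (rule emeasure_glued_measure_chart[OF chart_cover_subset[OF V_cover sub] \<theta> chart_image[OF \<theta> W(2,3)]])
         (use W(3) in auto)
    then show "emeasure ?G (\<theta> ` E) = (\<integral>\<^sup>+x\<in>E. ennreal (gram_density \<theta> x) \<partial>lborel)"
      by (simp add: emeasure_chart_measure_image[OF \<theta> W(2,3)])
  qed (simp add: space_restrict_space)
  moreover have "\<mu> = ?G" if \<mu>: "is_volume_measure TYPE('m) S \<mu>" for \<mu>
  proof (rule measure_eqI)
    show sets: "sets \<mu> = sets ?G"
      using \<mu> by (simp add: is_volume_measure_def sets_restrict_space)
    fix B assume "B \<in> sets \<mu>"
    then have B: "B \<in> sets borel" "B \<subseteq> S"
      using sets S_borel by (auto simp: sets_restrict_space_iff)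
    let ?D = "disjointed (\<lambda>k. \<psi> k ` V k)"
    have BD: "B \<inter> ?D k \<in> sets borel" for k
      using B(1) disjointed_chart_images[OF chart] by auto
    have BD': "B \<inter> ?D k \<in> sets \<mu>" for k
      using BD B(2) S_borel by (auto simp: sets sets_restrict_space_iff)
    have "emeasure \<mu> B = emeasure \<mu> (\<Union>k. B \<inter> ?D k)"
      using B(2) V(2) UN_disjointed_eq[of "\<lambda>k. \<psi> k ` V k"] by (intro arg_cong[where f = "emeasure \<mu>"]) blast
    also have "\<dots> = (\<Sum>k. emeasure \<mu> (B \<inter> ?D k))"
      using BD' disjoint_family_disjointed[of "\<lambda>k. \<psi> k ` V k"]
      by (intro suminf_emeasure[symmetric]) (auto simp: disjoint_family_on_def)
    also have "\<dots> = (\<Sum>k. emeasure (chart_measure (V k) (\<psi> k)) (B \<inter> ?D k))"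
    proof (rule suminf_cong)
      fix k
      let ?E = "V k \<inter> \<psi> k -` (B \<inter> ?D k)"
      have E: "?E \<in> sets borel"
        by (rule chart_vimage[OF chart BD])
      have im: "B \<inter> ?D k = \<psi> k ` ?E"
        using disjointed_subset[of "\<lambda>k. \<psi> k ` V k" k] by (intro chart_image_vimage) auto
      have "emeasure \<mu> (\<psi> k ` ?E) = (\<integral>\<^sup>+x\<in>?E. ennreal (gram_density (\<psi> k) x) \<partial>lborel)"
        using \<mu> V(1) E unfolding is_volume_measure_def by blast
      also have "\<dots> = emeasure (chart_measure (V k) (\<psi> k)) (\<psi> k ` ?E)"
        by (rule emeasure_chart_measure_image[OF chart E, symmetric]) auto
      finally show "emeasure \<mu> (B \<inter> ?D k) = emeasure (chart_measure (V k) (\<psi> k)) (B \<inter> ?D k)"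
        by (simp only: im[symmetric])
    qed
    also have "\<dots> = emeasure ?G B"
      by (simp add: emeasure_G[OF B(2)] emeasure_glued_measure[OF chart B(1)])
    finally show "emeasure \<mu> B = emeasure ?G B" .
  qed
  ultimately have "volume_measure TYPE('m) S = ?G"
    unfolding volume_measure_def by (rule the_equality)
  then show ?thesis
    using emeasure_G[OF A(2)] emeasure_glued_measure_unique[OF chart_cover_subset[OF V_cover A(2)] cover A(1)]
    by simp
qed

section \<open>The inductive volume measure\<close>

text \<open>Whatever submanifold \<open>SOME\<close> selects, its volume on subsets of
  \<open>C\<close> is determined by the cover.\<close>

lemma piece_volume_eq:
  fixes U :: "nat \<Rightarrow> (real ^ 'm::finite) set"
  assumes C: "C \<in> pieces TYPE('m)" and cover: "chart_cover U \<phi> C" and A: "A \<in> sets borel"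
  shows "piece_volume TYPE('m) C A = emeasure (glued_measure U \<phi>) (A \<inter> C)"
proof -
  have C': "C \<in> sets borel" "\<exists>S. submanifold TYPE('m) S \<and> C \<subseteq> S"
    using C by (auto simp: pieces_def)
  from someI_ex[OF C'(2)] show ?thesis
    unfolding piece_volume_def using C'(1) A
    by (intro emeasure_volume_measure chart_cover_subset[OF cover]) auto
qed

text \<open>The pieces may lie in different submanifolds, but finitely many countable chart families
  merge into one, whose glued measure becomes the common reference for all pieces.\<close>

lemma piece_unions_cover:
  assumes "M \<in> piece_unions TYPE('m::finite)"
  obtains U :: "nat \<Rightarrow> (real ^ 'm) set" and \<phi> :: "nat \<Rightarrow> real ^ 'm \<Rightarrow> real ^ 'n::finite"
    where "chart_cover U \<phi> M"
proof -
  obtain P where P: "finite P" "P \<subseteq> pieces TYPE('m)" "\<Union>P = M"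
    using assms by (auto simp: piece_unions_def decomposition_def)
  have "\<exists>c :: nat \<Rightarrow> (real ^ 'm) set \<times> (real ^ 'm \<Rightarrow> real ^ 'n).
      (\<forall>k. chart (fst (c k)) (snd (c k))) \<and> C \<subseteq> (\<Union>k. snd (c k) ` fst (c k))" if C: "C \<in> P" for C
  proof -
    obtain S where S: "submanifold TYPE('m) S" "C \<subseteq> S"
      using subsetD[OF P(2) C] by (auto simp: pieces_def)
    obtain U :: "nat \<Rightarrow> (real ^ 'm) set" and \<phi> where
      "\<And>k. local_parametrization S (U k) (\<phi> k)" "S = (\<Union>k. \<phi> k ` U k)"
      using submanifold_cover[OF S(1)] by metis
    then show ?thesis
      using S(2) by (intro exI[of _ "\<lambda>k. (U k, \<phi> k)"]) (auto intro: local_parametrization_imp_chart)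
  qed
  from bchoice[OF ballI[OF this]] obtain c :: "(real ^ 'n) set \<Rightarrow> nat \<Rightarrow> (real ^ 'm) set \<times> (real ^ 'm \<Rightarrow> real ^ 'n)" where
    c: "\<forall>C\<in>P. (\<forall>k. chart (fst (c C k)) (snd (c C k))) \<and> C \<subseteq> (\<Union>k. snd (c C k) ` fst (c C k))" ..
  have "\<exists>d :: nat \<Rightarrow> _. (\<forall>k. chart (fst (d k)) (snd (d k))) \<and> (\<Union>C\<in>P. range (c C)) \<subseteq> range d"
  proof (rule countable_enumeration[where d = "({}, undefined)" and P = "\<lambda>c. chart (fst c) (snd c)"])
    show "chart (fst e) (snd e)" if "e \<in> (\<Union>C\<in>P. range (c C))" for e
      using that c by auto
    show "chart (fst ({}, undefined)) (snd ({}, undefined))"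
      by (simp add: chart_def local_parametrization_empty)
  qed (use P(1) in \<open>simp add: countable_finite\<close>)
  then obtain d :: "nat \<Rightarrow> _" where d: "\<forall>k. chart (fst (d k)) (snd (d k))" "(\<Union>C\<in>P. range (c C)) \<subseteq> range d"
    by (elim exE conjE)
  have "M \<subseteq> (\<Union>k. snd (d k) ` fst (d k))"
  proof
    fix x assume "x \<in> M"
    then obtain C where C: "C \<in> P" "x \<in> C" using P(3) by blast
    then obtain k where k: "x \<in> snd (c C k) ` fst (c C k)" using c by blast
    have "c C k \<in> range d" using d(2) C(1) by blast
    then obtain j where "c C k = d j" by (rule rangeE)
    with k show "x \<in> (\<Union>k. snd (d k) ` fst (d k))"
      by (intro UN_I[of j]) simp_all
  qed
  with d(1) show thesis
    by (intro that[of "\<lambda>k. fst (d k)" "\<lambda>k. snd (d k)"]) (simp add: chart_cover_def)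
qed

text \<open>One cover of \<open>M\<close> serves every piece of the selected decomposition, so the
  sum is an instance of finite additivity of a single measure.\<close>

lemma union_volume_eq:
  fixes U :: "nat \<Rightarrow> (real ^ 'm::finite) set"
  assumes M: "M \<in> piece_unions TYPE('m)" and cover: "chart_cover U \<phi> M" and A: "A \<in> sets borel"
  shows "union_volume TYPE('m) M A = emeasure (glued_measure U \<phi>) (A \<inter> M)"
proof -
  define P where "P = (SOME P. decomposition TYPE('m) P M)"
  have "decomposition TYPE('m) P M"
    unfolding P_def by (rule someI_ex) (use M in \<open>auto simp: piece_unions_def\<close>)
  then have P: "finite P" "P \<subseteq> pieces TYPE('m)" "disjoint P" "\<Union>P = M"
    by (auto simp: decomposition_def)
  have "union_volume TYPE('m) M A = (\<Sum>C\<in>P. emeasure (glued_measure U \<phi>) (A \<inter> C))"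
    unfolding union_volume_def P_def[symmetric] using P(2,4)
    by (intro sum.cong refl piece_volume_eq chart_cover_subset[OF cover] A) auto
  also have "\<dots> = emeasure (glued_measure U \<phi>) (\<Union>C\<in>P. A \<inter> C)"
    using P(1,2) A disjointD[OF P(3)]
    by (intro sum_emeasure) (fastforce simp: pieces_def disjoint_family_on_def)+
  also have "(\<Union>C\<in>P. A \<inter> C) = A \<inter> M"
    using P(4) by blast
  finally show ?thesis .
qed

lemma piece_unions_borel: "M \<in> piece_unions T \<Longrightarrow> M \<in> sets borel"
  by (auto simp: piece_unions_def decomposition_def pieces_def subset_iff intro!: sets.finite_Union)

text \<open>This makes the index class directed. Removing \<open>M\<close> from the pieces of
  \<open>N\<close> keeps them Borel and inside their submanifolds.\<close>

lemma piece_unions_Un: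
  assumes "M \<in> piece_unions T" "N \<in> piece_unions T"
  shows "M \<union> N \<in> piece_unions T"
proof -
  obtain P Q where P: "decomposition T P M" and Q: "decomposition T Q N"
    using assms by (auto simp: piece_unions_def)
  have M: "M \<in> sets borel"
    using assms(1) by (rule piece_unions_borel)
  have "decomposition T (P \<union> (\<lambda>C. C - M) ` Q) (M \<union> N)"
    unfolding decomposition_def
  proof (intro conjI)
    show "P \<union> (\<lambda>C. C - M) ` Q \<subseteq> pieces T"
    proof -
      have "C - M \<in> pieces T" if "C \<in> pieces T" for C
        using that M by (auto simp: pieces_def)
      then show ?thesis
        using P Q by (auto simp: decomposition_def)
    qed
    show "disjoint (P \<union> (\<lambda>C. C - M) ` Q)"
    proof (rule disjointI)
      fix X Y
      assume XY: "X \<in> P \<union> (\<lambda>C. C - M) ` Q" "Y \<in> P \<union> (\<lambda>C. C - M) ` Q" "X \<noteq> Y"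
      have sub: "Z \<subseteq> M" if "Z \<in> P" for Z
        using that P by (auto simp: decomposition_def)
      from XY(1,2) consider "X \<in> P" "Y \<in> P" | "X \<in> P" "Y \<inter> M = {}" | "X \<inter> M = {}" "Y \<in> P"
        | C D where "C \<in> Q" "D \<in> Q" "X = C - M" "Y = D - M"
        by (elim UnE imageE) blast+
      then show "X \<inter> Y = {}"
      proof cases
        case 1
        then show ?thesis
          using P XY(3) disjointD[of P X Y] by (simp add: decomposition_def)
      next
        case 4
        then have "C \<inter> D = {}"
          using Q XY(3) disjointD[of Q C D] by (auto simp: decomposition_def)
        then show ?thesis using 4 by blast
      qed (use sub in blast)+
    qed
  qed (use P Q in \<open>auto simp: decomposition_def\<close>)
  then show ?thesis
    by (auto simp: piece_unions_def)
qed

lemma union_volume_mono: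
  fixes M N :: "(real ^ 'n::finite) set"
  assumes M: "M \<in> piece_unions TYPE('m::finite)" and N: "N \<in> piece_unions TYPE('m)"
    and "M \<subseteq> N" and A: "A \<in> sets borel"
  shows "union_volume TYPE('m) M A \<le> union_volume TYPE('m) N A"
proof -
  obtain U :: "nat \<Rightarrow> (real ^ 'm) set" and \<phi> where cover: "chart_cover U \<phi> N"
    using piece_unions_cover[OF N] by metis
  show ?thesis
    unfolding union_volume_eq[OF N cover A] union_volume_eq[OF M chart_cover_subset[OF cover \<open>M \<subseteq> N\<close>] A]
    using \<open>M \<subseteq> N\<close> A piece_unions_borel[OF N] by (intro emeasure_mono) auto
qed

lemma sets_inductive_volume [simp, measurable_cong]: "sets (inductive_volume T) = sets borel"
  unfolding inductive_volume_def by (rule sets.sets_measure_of_eq[of borel, unfolded space_borel])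

text \<open>\<open>measure_of\<close> returns the prescribed values only for a countably additive
  function. Sum and supremum may be exchanged because the index class is directed and
  \<open>union_volume\<close> grows along it; for a fixed union, additivity is that of a glued
  measure.\<close>

lemma emeasure_inductive_volume:
  fixes A :: "(real ^ 'n::finite) set"
  assumes A: "A \<in> sets borel"
  shows "emeasure (inductive_volume TYPE('m::finite)) A
    = (SUP M\<in>piece_unions TYPE('m). union_volume TYPE('m) M A)"
proof (rule emeasure_measure_of[OF inductive_volume_def])
  let ?v = "\<lambda>M A :: (real ^ 'n) set. union_volume TYPE('m) M A"
  have empty: "union_volume TYPE('m) M ({} :: (real ^ 'n) set) = 0" if M: "M \<in> piece_unions TYPE('m)" for M
  proof -
    obtain U :: "nat \<Rightarrow> (real ^ 'm) set" and \<phi> where "chart_cover U \<phi> M"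
      using piece_unions_cover[OF M] by metis
    from union_volume_eq[OF M this] show ?thesis by simp
  qed
  show "countably_additive (sets (inductive_volume TYPE('m))) (\<lambda>A. SUP M\<in>piece_unions TYPE('m). ?v M A)"
  proof (rule countably_additiveI)
    fix B :: "nat \<Rightarrow> (real ^ 'n) set"
    assume "range B \<subseteq> sets (inductive_volume TYPE('m))" and disj: "disjoint_family B"
    then have B: "B i \<in> sets borel" for i by auto
    have "(\<Sum>i. SUP M\<in>piece_unions TYPE('m). ?v M (B i)) = (SUP M\<in>piece_unions TYPE('m). \<Sum>i. ?v M (B i))"
    proof (rule ennreal_suminf_SUP_eq_directed)
      fix N :: "nat set" and M M' :: "(real ^ 'n) set"
      assume M: "M \<in> piece_unions TYPE('m)" "M' \<in> piece_unions TYPE('m)"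
      then show "\<exists>K\<in>piece_unions TYPE('m). \<forall>n\<in>N. ?v M (B n) \<le> ?v K (B n) \<and> ?v M' (B n) \<le> ?v K (B n)"
        using B by (intro bexI[of _ "M \<union> M'"] ballI conjI union_volume_mono piece_unions_Un) auto
    qed
    also have "\<dots> = (SUP M\<in>piece_unions TYPE('m). ?v M (\<Union>i. B i))"
    proof (rule SUP_cong[OF refl])
      fix M :: "(real ^ 'n) set" assume M: "M \<in> piece_unions TYPE('m)"
      obtain U :: "nat \<Rightarrow> (real ^ 'm) set" and \<phi> where cover: "chart_cover U \<phi> M"
        using piece_unions_cover[OF M] by metis
      have "(\<Sum>i. emeasure (glued_measure U \<phi>) (B i \<inter> M)) = emeasure (glued_measure U \<phi>) (\<Union>i. B i \<inter> M)"
        using B disj piece_unions_borel[OF M] by (intro suminf_emeasure) (auto simp: disjoint_family_on_def)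
      also have "(\<Union>i. B i \<inter> M) = (\<Union>i. B i) \<inter> M"
        by blast
      finally show "(\<Sum>i. ?v M (B i)) = ?v M (\<Union>i. B i)"
        using B by (simp add: union_volume_eq[OF M cover])
    qed
    finally show "(\<Sum>i. SUP M\<in>piece_unions TYPE('m). ?v M (B i)) = (SUP M\<in>piece_unions TYPE('m). ?v M (\<Union>i. B i))" .
  qed
  show "positive (sets (inductive_volume TYPE('m))) (\<lambda>A. SUP M\<in>piece_unions TYPE('m). ?v M A)"
    by (auto simp: positive_def empty intro!: antisym SUP_least)
qed (use A in auto)

text \<open>The supremum is attained at the chart image itself, a submanifold and hence a single
  piece; any other union measures only its part of \<open>A\<close>, with the same chart
  measure.\<close>

lemma emeasure_inductive_volume_chart:
  fixes \<psi> :: "real ^ 'm::finite \<Rightarrow> real ^ 'n::finite"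
  assumes \<psi>: "chart V \<psi>" and A: "A \<in> sets borel" "A \<subseteq> \<psi> ` V"
  shows "emeasure (inductive_volume TYPE('m)) A = emeasure (chart_measure V \<psi>) A"
  unfolding emeasure_inductive_volume[OF A(1)]
proof (rule antisym)
  show "(SUP M\<in>piece_unions TYPE('m). union_volume TYPE('m) M A) \<le> emeasure (chart_measure V \<psi>) A"
  proof (rule SUP_least)
    fix M :: "(real ^ 'n) set" assume M: "M \<in> piece_unions TYPE('m)"
    obtain U :: "nat \<Rightarrow> (real ^ 'm) set" and \<phi> where cover: "chart_cover U \<phi> M"
      using piece_unions_cover[OF M] by metis
    have "union_volume TYPE('m) M A = emeasure (glued_measure U \<phi>) (A \<inter> M)"
      by (rule union_volume_eq[OF M cover A(1)])
    also have "\<dots> = emeasure (chart_measure V \<psi>) (A \<inter> M)"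
      using A piece_unions_borel[OF M]
      by (intro emeasure_glued_measure_chart[OF _ \<psi>] chart_cover_subset[OF cover]) auto
    also have "\<dots> \<le> emeasure (chart_measure V \<psi>) A"
      using A(1) by (intro emeasure_mono) auto
    finally show "union_volume TYPE('m) M A \<le> emeasure (chart_measure V \<psi>) A" .
  qed
next
  let ?M = "\<psi> ` V"
  have "submanifold TYPE('m) ?M"
    using \<psi> unfolding submanifold_def chart_def by blast
  then have "decomposition TYPE('m) {?M} ?M"
    using chart_image[OF \<psi> chart_borel[OF \<psi>]] by (auto simp: decomposition_def pieces_def)
  then have M: "?M \<in> piece_unions TYPE('m)"
    by (auto simp: piece_unions_def)
  have cover: "chart_cover (\<lambda>_. V) (\<lambda>_. \<psi>) ?M"
    using \<psi> by (simp add: chart_cover_def)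
  have "emeasure (chart_measure V \<psi>) A = emeasure (glued_measure (\<lambda>_. V) (\<lambda>_. \<psi>)) A"
    by (rule emeasure_glued_measure_chart[OF chart_cover_subset[OF cover A(2)] \<psi> A, symmetric])
  also have "\<dots> = union_volume TYPE('m) ?M A"
    using A by (simp add: union_volume_eq[OF M cover A(1)] Int_absorb2)
  also have "\<dots> \<le> (SUP M\<in>piece_unions TYPE('m). union_volume TYPE('m) M A)"
    by (rule SUP_upper[OF M])
  finally show "emeasure (chart_measure V \<psi>) A \<le> (SUP M\<in>piece_unions TYPE('m). union_volume TYPE('m) M A)" .
qed

lemma nn_integral_inductive_volume_chart:
  fixes \<psi> :: "real ^ 'm::finite \<Rightarrow> real ^ 'n::finite"
  assumes \<psi>: "chart V \<psi>" and g [measurable]: "g \<in> borel_measurable borel"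
  shows "(\<integral>\<^sup>+x\<in>\<psi> ` V. g x \<partial>inductive_volume TYPE('m))
    = (\<integral>\<^sup>+y\<in>V. ennreal (gram_density \<psi> y) * g (\<psi> y) \<partial>lborel)"
proof -
  have im [measurable]: "\<psi> ` V \<in> sets borel"
    by (rule chart_image[OF \<psi> chart_borel[OF \<psi>]]) simp
  have "density (inductive_volume TYPE('m)) (indicator (\<psi> ` V)) = chart_measure V \<psi>"
  proof (rule measure_eqI)
    fix A assume "A \<in> sets (density (inductive_volume TYPE('m)) (indicator (\<psi> ` V)))"
    then have A: "A \<in> sets borel" by simp
    then have "emeasure (density (inductive_volume TYPE('m)) (indicator (\<psi> ` V))) A
        = emeasure (inductive_volume TYPE('m)) (\<psi> ` V \<inter> A)"
      using im by (simp add: emeasure_density indicator_inter_arith[symmetric])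
    also have "\<dots> = emeasure (chart_measure V \<psi>) (\<psi> ` V \<inter> A)"
      using A im by (intro emeasure_inductive_volume_chart[OF \<psi>]) auto
    also have "\<dots> = emeasure (chart_measure V \<psi>) A"
    proof -
      have "V \<inter> \<psi> -` (\<psi> ` V \<inter> A) = V \<inter> \<psi> -` A" by blast
      then show ?thesis
        using A im by (simp add: emeasure_chart_measure[OF \<psi>])
    qed
    finally show "emeasure (density (inductive_volume TYPE('m)) (indicator (\<psi> ` V))) A
        = emeasure (chart_measure V \<psi>) A" .
  qed simp
  then have "(\<integral>\<^sup>+x. g x \<partial>density (inductive_volume TYPE('m)) (indicator (\<psi> ` V))) = (\<integral>\<^sup>+x. g x \<partial>chart_measure V \<psi>)"
    by simp
  then show ?thesis
    by (simp add: nn_integral_density nn_integral_chart_measure[OF \<psi>] mult.commute)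
qed

section \<open>The coarea formula\<close>

text \<open>The matrix is the identity plus the outer product of \<open>q\<close> with itself, the
  Gram matrix of a graph with slope \<open>q\<close>. A rotation taking an axis to the direction of
  \<open>q\<close> diagonalizes it, with \<open>1 + (norm q)\<^sup>2\<close> once and 1
  otherwise.\<close>

lemma det_identity_plus_outer:
  fixes q :: "real ^ 'n::finite"
  shows "det (\<chi> i j. (if i = j then 1 else 0) + q $ i * q $ j) = 1 + (norm q)\<^sup>2"
proof -
  obtain k :: 'n where True by simp
  have "\<exists>T. orthogonal_transformation T \<and> T (norm q *\<^sub>R axis k (1 :: real)) = q"
  proof (rule rotation_rightward_line[of q k])
    fix f assume "orthogonal_transformation f" "f (norm q *\<^sub>R axis k (1 :: real)) = q"
    then show ?thesis by (intro exI[of _ f] conjI)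
  qed
  then obtain T where T: "orthogonal_transformation T" and q: "T (norm q *\<^sub>R axis k (1 :: real)) = q"
    by (elim exE conjE)
  define Q where "Q = matrix T"
  have Q: "orthogonal_matrix Q" "linear T"
    using T by (simp_all add: Q_def orthogonal_transformation_matrix)
  have q': "q $ i = norm q * Q $ i $ k" for i
  proof -
    have "q $ i = (norm q *\<^sub>R T (axis k 1)) $ i"
      using q linear_scale[OF Q(2), of "norm q" "axis k 1"] by simp
    then show ?thesis by (simp add: Q_def matrix_def)
  qed
  define E :: "real ^ 'n ^ 'n" where
    "E = (\<chi> i j. if i = j then (if i = k then 1 + (norm q)\<^sup>2 else 1) else 0)"
  have "(\<chi> i j. (if i = j then 1 else 0) + q $ i * q $ j) = Q ** E ** transpose Q"
  proof -
    have QQ: "(\<Sum>l\<in>UNIV. Q $ i $ l * Q $ j $ l) = (if i = j then 1 else 0)" for i j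
    proof -
      have "(Q ** transpose Q) $ i $ j = mat 1 $ i $ j"
        using Q(1) by (simp add: orthogonal_matrix_def)
      then show ?thesis by (simp add: matrix_matrix_mult_def transpose_def mat_def)
    qed
    have QE: "(Q ** E) $ i $ l = Q $ i $ l + (if l = k then (norm q)\<^sup>2 * Q $ i $ k else 0)" for i l
    proof -
      have "(Q ** E) $ i $ l = (\<Sum>j\<in>UNIV. Q $ i $ j * E $ j $ l)"
        by (simp add: matrix_matrix_mult_def)
      also have "\<dots> = (\<Sum>j\<in>UNIV. if j = l then Q $ i $ l * (if l = k then 1 + (norm q)\<^sup>2 else 1) else 0)"
        by (rule sum.cong) (auto simp: E_def)
      finally have "(Q ** E) $ i $ l = \<dots>" .
      then show ?thesis by (auto simp: algebra_simps)
    qed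
    have "(Q ** E ** transpose Q) $ i $ j = (if i = j then 1 else 0) + q $ i * q $ j" for i j
    proof -
      have "(Q ** E ** transpose Q) $ i $ j = (\<Sum>l\<in>UNIV. (Q ** E) $ i $ l * Q $ j $ l)"
        by (simp add: matrix_matrix_mult_def transpose_def)
      also have "\<dots> = (\<Sum>l\<in>UNIV. Q $ i $ l * Q $ j $ l + (if l = k then (norm q)\<^sup>2 * Q $ i $ k * Q $ j $ k else 0))"
        unfolding QE by (intro sum.cong refl) (simp add: distrib_right)
      also have "\<dots> = (if i = j then 1 else 0) + (norm q)\<^sup>2 * Q $ i $ k * Q $ j $ k"
        by (simp add: sum.distrib QQ)
      finally show ?thesis
        by (simp add: q'[of i] q'[of j] power2_eq_square)
    qed
    then show ?thesis
      by (simp add: vec_eq_iff)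
  qed
  then have "det (\<chi> i j. (if i = j then 1 else 0) + q $ i * q $ j) = det E * (det Q)\<^sup>2"
    by (simp add: det_mul power2_eq_square)
  also have "(det Q)\<^sup>2 = 1"
    using det_orthogonal_matrix[OF Q(1)] by auto
  also have "det E = (\<Prod>i\<in>UNIV. E $ i $ i)"
    by (rule det_diagonal) (simp add: E_def)
  also have "\<dots> = 1 + (norm q)\<^sup>2"
    by (simp add: E_def prod.delta)
  finally show ?thesis by simp
qed

section \<open>Splitting off one coordinate\<close>

text \<open>Here \<open>\<sigma>\<close> is meant to enumerate the coordinates other than
  \<open>i\<close>. The value of \<open>inv \<sigma>\<close> at \<open>i\<close> is arbitrary, and
  the case distinction shields from it.\<close>

definition insert_coord :: "'n \<Rightarrow> ('m \<Rightarrow> 'n) \<Rightarrow> (real ^ 'm::finite) \<times> real \<Rightarrow> real ^ 'n::finite" where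
  "insert_coord i \<sigma> p = (\<chi> j. if j = i then snd p else fst p $ inv \<sigma> j)"

lemma insert_coord_nth [simp]:
  assumes "bij_betw \<sigma> UNIV (- {i})"
  shows "insert_coord i \<sigma> p $ i = snd p" "insert_coord i \<sigma> p $ \<sigma> k = fst p $ k"
  using assms by (auto simp: insert_coord_def bij_betw_def)

lemma all_coord_iff:
  assumes "bij_betw \<sigma> UNIV (- {i})"
  shows "(\<forall>j. P j) \<longleftrightarrow> P i \<and> (\<forall>k. P (\<sigma> k))"
  using assms unfolding bij_betw_def by (metis ComplI imageE singletonD)

lemma sum_coord:
  fixes f :: "'n::finite \<Rightarrow> real"
  assumes "bij_betw \<sigma> (UNIV :: 'm::finite set) (- {i})"
  shows "(\<Sum>j\<in>UNIV. f j) = f i + (\<Sum>k\<in>UNIV. f (\<sigma> k))"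
proof -
  have "(\<Sum>j\<in>UNIV. f j) = f i + (\<Sum>j\<in>- {i}. f j)"
    by (subst sum.remove[of _ i]) (auto simp: Compl_eq_Diff_UNIV)
  then show ?thesis
    using sum.reindex_bij_betw[OF assms, of f] by simp
qed

lemma linear_insert_coord: "linear (insert_coord i \<sigma>)"
  by (rule linearI) (auto simp: insert_coord_def vec_eq_iff)

lemma bij_betw_insert_coord_Basis:
  fixes \<sigma> :: "'m::finite \<Rightarrow> 'n::finite"
  assumes "bij_betw \<sigma> UNIV (- {i})"
  shows "bij_betw (insert_coord i \<sigma>) Basis Basis"
proof -
  have 1: "insert_coord i \<sigma> (axis k 1, 0) = axis (\<sigma> k) 1" for k
    using assms by (subst vec_eq_iff, subst all_coord_iff[OF assms])
      (auto simp: axis_def bij_betw_def inj_eq)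
  have 2: "insert_coord i \<sigma> (0, 1) = axis i 1"
    using assms by (subst vec_eq_iff, subst all_coord_iff[OF assms])
      (auto simp: axis_def bij_betw_def)
  have 3: "Basis = insert (0, 1) (range (\<lambda>k :: 'm. (axis k 1, 0)) :: ((real ^ 'm) \<times> real) set)"
    by (auto simp: Basis_prod_def Basis_vec_def)
  have "insert_coord i \<sigma> ` Basis = insert (axis i 1) (range (\<lambda>k. axis (\<sigma> k) 1))"
    by (simp add: 3 1 2 image_comp o_def)
  also have "\<dots> = Basis"
  proof -
    have "UNIV = insert i (range \<sigma>)"
      using assms by (auto simp: bij_betw_def)
    from arg_cong[OF this, of "image (\<lambda>j. axis j (1 :: real))"]
    have "range (\<lambda>j. axis j (1 :: real)) = insert (axis i 1) (range (\<lambda>k. axis (\<sigma> k) 1))"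
      by (simp only: image_insert image_image)
    then show ?thesis
      by (auto simp: Basis_vec_def)
  qed
  finally have "insert_coord i \<sigma> ` Basis = Basis" .
  moreover have "inj (insert_coord i \<sigma>)"
  proof (rule injI)
    fix p p' assume eq: "insert_coord i \<sigma> p = insert_coord i \<sigma> p'"
    have "snd p = snd p'" "fst p $ k = fst p' $ k" for k
      using arg_cong[OF eq, of "\<lambda>z. z $ i"] arg_cong[OF eq, of "\<lambda>z. z $ \<sigma> k"]
      by (simp_all add: insert_coord_nth[OF assms])
    then show "p = p'"
      by (simp add: prod_eq_iff vec_eq_iff)
  qed
  ultimately show ?thesis
    by (simp add: bij_betw_def inj_on_subset[OF _ subset_UNIV])
qed

lemma measurable_insert_coord [measurable]: "insert_coord i \<sigma> \<in> borel_measurable borel"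
  by (simp add: borel_measurable_continuous_onI linear_continuous_on linear_linear linear_insert_coord)

text \<open>Tonelli's theorem combined with the invariance of Lebesgue measure under
  \<open>insert_coord\<close>; the level is the outer variable.\<close>

lemma nn_integral_insert_coord:
  assumes \<sigma>: "bij_betw \<sigma> UNIV (- {i})" and K [measurable]: "K \<in> borel_measurable borel"
  shows "(\<lambda>t. \<integral>\<^sup>+y. K (insert_coord i \<sigma> (y, t)) \<partial>lborel) \<in> borel_measurable borel"
    and "(\<integral>\<^sup>+t. \<integral>\<^sup>+y. K (insert_coord i \<sigma> (y, t)) \<partial>lborel \<partial>lborel) = (\<integral>\<^sup>+z. K z \<partial>lborel)"
proof -
  have [measurable]: "insert_coord i \<sigma> \<in> borel_measurable (lborel \<Otimes>\<^sub>M lborel)"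
    by (simp add: lborel_prod)
  have "(\<lambda>p. K (insert_coord i \<sigma> p)) \<in> borel_measurable (lborel \<Otimes>\<^sub>M lborel)"
    by measurable
  then have "(\<integral>\<^sup>+t. \<integral>\<^sup>+y. K (insert_coord i \<sigma> (y, t)) \<partial>lborel \<partial>lborel)
      = (\<integral>\<^sup>+p. K (insert_coord i \<sigma> p) \<partial>(lborel \<Otimes>\<^sub>M lborel))"
    by (rule lborel_pair.nn_integral_snd)
  also have "\<dots> = (\<integral>\<^sup>+z. K z \<partial>distr lborel borel (insert_coord i \<sigma>))"
    unfolding lborel_prod by (subst nn_integral_distr) measurable
  also have "distr lborel borel (insert_coord i \<sigma>) = lborel"
    by (rule lborel_distr_basis_bij[OF linear_insert_coord bij_betw_insert_coord_Basis[OF \<sigma>]])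
  finally show "(\<integral>\<^sup>+t. \<integral>\<^sup>+y. K (insert_coord i \<sigma> (y, t)) \<partial>lborel \<partial>lborel) = (\<integral>\<^sup>+z. K z \<partial>lborel)" .
  have "(\<lambda>(t, y). K (insert_coord i \<sigma> (y, t))) \<in> borel_measurable (lborel \<Otimes>\<^sub>M lborel)"
    by measurable
  from lborel.borel_measurable_nn_integral[OF this]
  show "(\<lambda>t. \<integral>\<^sup>+y. K (insert_coord i \<sigma> (y, t)) \<partial>lborel) \<in> borel_measurable borel"
    by simp
qed

text \<open>Both sides become the Lebesgue integral of \<open>K\<close>: the volume integral by the
  change of variables along \<open>\<Phi>\<close>, the iterated one slice by slice in the charts
  \<open>\<phi> t\<close>. The set \<open>W\<close> is found before \<open>g\<close>, so one
  neighbourhood serves all integrands.\<close>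

lemma local_coarea:
  fixes H :: "real ^ 'n::finite \<Rightarrow> real" and G :: "real ^ 'n \<Rightarrow> real ^ 'n"
  assumes card: "CARD('n) = Suc CARD('m::finite)"
    and der: "\<And>x. (H has_derivative (\<lambda>v. G x \<bullet> v)) (at x)"
    and cont: "continuous_on UNIV G" and x0: "G x0 \<noteq> 0"
  shows "\<exists>W. open W \<and> x0 \<in> W \<and> W \<subseteq> {x. G x \<noteq> 0} \<and>
    (\<forall>g\<in>borel_measurable borel.
      (\<lambda>t. \<integral>\<^sup>+x\<in>W \<inter> H -` {t}. g x * ennreal (inverse (norm (G x))) \<partial>inductive_volume TYPE('m)) \<in> borel_measurable borel \<and>
      (\<integral>\<^sup>+x\<in>W. g x \<partial>lborel)
        = (\<integral>\<^sup>+t. (\<integral>\<^sup>+x\<in>W \<inter> H -` {t}. g x * ennreal (inverse (norm (G x))) \<partial>inductive_volume TYPE('m)) \<partial>lborel))"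
proof -
  obtain i where i: "G x0 $ i \<noteq> 0"
    using x0 by (auto simp: vec_eq_iff)
  have "CARD('m) = card (- {i})"
    using card by (simp add: Compl_eq_Diff_UNIV)
  then obtain \<sigma> :: "'m \<Rightarrow> 'n" where \<sigma>: "bij_betw \<sigma> UNIV (- {i})"
    using finite_same_card_bij[of "UNIV :: 'm set" "- {i}"] by auto
  note [simp] = insert_coord_nth[OF \<sigma>]
  have \<sigma>i: "\<sigma> k \<noteq> i" for k
    using \<sigma> by (auto simp: bij_betw_def)
  define e :: "real ^ 'n" where "e = axis i 1"
  have e_nth [simp]: "e $ i = 1" "e $ \<sigma> k = 0" for k
    using \<sigma>i[of k] by (auto simp: e_def axis_def)
  have inner_e [simp]: "x \<bullet> e = x $ i" "e \<bullet> x = x $ i" for x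
    by (simp_all add: e_def inner_axis inner_axis')
  define S where "S = {x. G x $ i \<noteq> 0}"
  have "open S"
    unfolding S_def by (intro open_Collect_neq continuous_intros cont)
  define \<Phi> where "\<Phi> x = x + (H x - x $ i) *\<^sub>R e" for x
  define \<Phi>' where "\<Phi>' x v = v + ((G x - e) \<bullet> v) *\<^sub>R e" for x v
  \<comment> \<open>The inverse of the rank-one update \<open>\<Phi>' x\<close>, whose determinant
    is \<open>G x $ i\<close>.\<close>
  define \<Psi>' where "\<Psi>' x v = v - (((G x - e) \<bullet> v) / G x $ i) *\<^sub>R e" for x v
  have der\<Phi>: "(\<Phi> has_derivative \<Phi>' x) (at x)" for x
  proof -
    have "((\<lambda>x. x + (H x - e \<bullet> x) *\<^sub>R e) has_derivative (\<lambda>v. v + (G x \<bullet> v - e \<bullet> v) *\<^sub>R e)) (at x)"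
      by (intro has_derivative_add has_derivative_ident has_derivative_scaleR_left has_derivative_diff
          has_derivative_inner_right der)
    then show ?thesis
      by (simp add: \<Phi>_def[abs_def] \<Phi>'_def[abs_def] inner_diff_left)
  qed
  have \<Psi>\<Phi>: "\<Psi>' x (\<Phi>' x v) = v" "\<Phi>' x (\<Psi>' x v) = v" if "x \<in> S" for x v
    using that by (auto simp: S_def \<Psi>'_def \<Phi>'_def inner_diff_left inner_add_right inner_diff_right
        vec_eq_iff field_simps)
  \<comment> \<open>The derivatives as elements of the operator space, in which
    \<open>inverse_function_theorem\<close> requires continuity.\<close>
  define B where "B x = id_blinfun + (blinfun_scaleR_left e o\<^sub>L blinfun_inner_right (G x - e))" for x
  have B: "blinfun_apply (B x) = \<Phi>' x" for x
    by (simp add: B_def \<Phi>'_def fun_eq_iff blinfun.add_left)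
  have contB: "continuous_on S B"
    unfolding B_def
    by (intro continuous_intros continuous_on_subset[OF cont]) auto
  define B0 where "B0 = id_blinfun - (blinfun_scaleR_left e o\<^sub>L ((1 / G x0 $ i) *\<^sub>R blinfun_inner_right (G x0 - e)))"
  have B0: "blinfun_apply B0 = \<Psi>' x0"
    by (simp add: B0_def \<Psi>'_def fun_eq_iff blinfun.diff_left blinfun.scaleR_left)
  have inv: "B0 o\<^sub>L B x0 = id_blinfun"
    using \<Psi>\<Phi>(1)[of x0] i by (intro blinfun_eqI) (simp add: B B0 S_def)
  obtain W V \<Psi> D where W: "open W" "W \<subseteq> S" "x0 \<in> W" and V: "open V" and hom: "homeomorphism W V \<Phi> \<Psi>"
    and der\<Psi>: "\<And>y. y \<in> V \<Longrightarrow> (\<Psi> has_derivative D y) (at y)"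
    and D: "\<And>y. y \<in> V \<Longrightarrow> D y = inv (blinfun_apply (B (\<Psi> y)))"
    by (rule inverse_function_theorem[OF \<open>open S\<close> _ contB _ inv, of \<Phi>])
       (use i der\<Phi> in \<open>auto simp: B S_def\<close>)
  have \<Psi>W: "\<Psi> z \<in> W" "\<Phi> (\<Psi> z) = z" if "z \<in> V" for z
    using hom that by (auto simp: homeomorphism_def)
  have \<Phi>V: "\<Phi> x \<in> V" "\<Psi> (\<Phi> x) = x" if "x \<in> W" for x
    using hom that by (auto simp: homeomorphism_def)
  have D_eq: "D z = \<Psi>' (\<Psi> z)" if "z \<in> V" for z
    unfolding D[OF that] B
    using \<Psi>W(1)[OF that] W(2) \<Psi>\<Phi> by (intro inv_equality) auto
  define U where "U t = {y. insert_coord i \<sigma> (y, t) \<in> V}" for t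
  define \<phi> where "\<phi> t y = \<Psi> (insert_coord i \<sigma> (y, t))" for t y
  \<comment> \<open>On \<open>W\<close>, \<open>c x\<close> is the projection along \<open>e\<close>
    onto the kernel of the derivative of \<open>H\<close>; it agrees with \<open>\<Psi>' x\<close>
    on vectors whose \<open>i\<close>-th coordinate is 0.\<close>
  define c where "c x v = v - ((G x \<bullet> v) / G x $ i) *\<^sub>R e" for x v
  have \<phi>W: "\<phi> t y \<in> W" if "y \<in> U t" for t y
    using that \<Psi>W by (auto simp: U_def \<phi>_def)
  have \<phi>_nth: "\<phi> t y $ \<sigma> k = y $ k" and H\<phi>: "H (\<phi> t y) = t" if "y \<in> U t" for t y k
  proof -
    have *: "\<Phi> (\<phi> t y) = insert_coord i \<sigma> (y, t)"
      using that \<Psi>W by (auto simp: U_def \<phi>_def)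
    from arg_cong[OF *, of "\<lambda>z. z $ \<sigma> k"] show "\<phi> t y $ \<sigma> k = y $ k"
      by (simp add: \<Phi>_def)
    from arg_cong[OF *, of "\<lambda>z. z $ i"] show "H (\<phi> t y) = t"
      by (simp add: \<Phi>_def)
  qed
  have im: "\<phi> t ` U t = W \<inter> H -` {t}" for t
  proof
    show "W \<inter> H -` {t} \<subseteq> \<phi> t ` U t"
    proof
      fix x assume x: "x \<in> W \<inter> H -` {t}"
      define y where "y = (\<chi> k. x $ \<sigma> k)"
      have "insert_coord i \<sigma> (y, t) = \<Phi> x"
        using x by (subst vec_eq_iff, subst all_coord_iff[OF \<sigma>]) (simp add: \<Phi>_def y_def)
      then have "y \<in> U t" "\<phi> t y = x"
        using \<Phi>V[of x] x by (auto simp: U_def \<phi>_def)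
      then show "x \<in> \<phi> t ` U t" by blast
    qed
  qed (use \<phi>W H\<phi> in auto)
  have derins: "((\<lambda>y. insert_coord i \<sigma> (y, t)) has_derivative (\<lambda>v. insert_coord i \<sigma> (v, 0))) (at y)" for t y
  proof -
    have "((\<lambda>y. insert_coord i \<sigma> (y, 0) + t *\<^sub>R e) has_derivative (\<lambda>v. insert_coord i \<sigma> (v, 0) + 0)) (at y)"
    proof (intro has_derivative_add has_derivative_const linear_imp_has_derivative)
      show "linear (\<lambda>v. insert_coord i \<sigma> (v, 0))"
        by (rule linearI; subst vec_eq_iff, subst all_coord_iff[OF \<sigma>]) auto
    qed
    moreover have "insert_coord i \<sigma> (y, 0) + t *\<^sub>R e = insert_coord i \<sigma> (y, t)" for y
      by (subst vec_eq_iff, subst all_coord_iff[OF \<sigma>]) auto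
    ultimately show ?thesis by simp
  qed
  have contins: "continuous_on A (\<lambda>y. insert_coord i \<sigma> (y, t))" for t A
    by (intro continuous_at_imp_continuous_on ballI has_derivative_continuous[OF derins])
  have der\<phi>: "(\<phi> t has_derivative (\<lambda>v. c (\<phi> t y) (insert_coord i \<sigma> (v, 0)))) (at y)" if "y \<in> U t" for t y
  proof -
    have "insert_coord i \<sigma> (y, t) \<in> V"
      using that by (simp add: U_def)
    from has_derivative_compose[OF derins der\<Psi>[OF this], unfolded D_eq[OF this]]
    have "(\<phi> t has_derivative (\<lambda>v. \<Psi>' (\<phi> t y) (insert_coord i \<sigma> (v, 0)))) (at y)"
      by (simp add: \<phi>_def[abs_def])
    moreover have "\<Psi>' x (insert_coord i \<sigma> (v, 0)) = c x (insert_coord i \<sigma> (v, 0))" for x and v :: "real ^ 'm"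
      by (simp add: \<Psi>'_def c_def inner_diff_left)
    ultimately show ?thesis by simp
  qed
  have fder: "frechet_derivative (\<phi> t) (at y) = (\<lambda>v. c (\<phi> t y) (insert_coord i \<sigma> (v, 0)))" if "y \<in> U t" for t y
    using frechet_derivative_at[OF der\<phi>[OF that]] by simp
  have GW: "G x $ i \<noteq> 0" if "x \<in> W" for x
    using that W(2) by (auto simp: S_def)
  have cont\<phi>: "continuous_on (U t) (\<phi> t)" for t
    by (intro continuous_at_imp_continuous_on ballI has_derivative_continuous[OF der\<phi>])
  have chart: "chart (U t) (\<phi> t)" for t
    unfolding chart_def local_parametrization_def
  proof (intro conjI)
    show "open (U t)"
    proof -
      have "U t = (\<lambda>y. insert_coord i \<sigma> (y, t)) -` V"
        by (auto simp: U_def)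
      then show ?thesis
        using open_vimage[OF V contins] by simp
    qed
    show "Ck_on 1 (U t) (\<phi> t)"
    proof -
      have "continuous_on (U t) (\<lambda>y. c (\<phi> t y) (insert_coord i \<sigma> (v, 0)))" for v
        unfolding c_def using GW \<phi>W
        by (intro continuous_intros continuous_on_compose2[OF cont cont\<phi>]) auto
      then have "continuous_on (U t) (\<lambda>y. frechet_derivative (\<phi> t) (at y) v)" for v
        using fder by (simp cong: continuous_on_cong)
      then show ?thesis
        using der\<phi> by (auto simp: One_nat_def differentiable_def)
    qed
    show "\<forall>y\<in>U t. inj (frechet_derivative (\<phi> t) (at y))"
    proof
      fix y assume y: "y \<in> U t"
      show "inj (frechet_derivative (\<phi> t) (at y))"
        unfolding fder[OF y]
      proof (rule injI)
        fix u v assume "c (\<phi> t y) (insert_coord i \<sigma> (u, 0)) = c (\<phi> t y) (insert_coord i \<sigma> (v, 0))"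
        then have "c (\<phi> t y) (insert_coord i \<sigma> (u, 0)) $ \<sigma> k = c (\<phi> t y) (insert_coord i \<sigma> (v, 0)) $ \<sigma> k" for k
          by simp
        then show "u = v"
          by (simp add: c_def vec_eq_iff)
      qed
    qed
    show "\<exists>\<theta>. homeomorphism (U t) (\<phi> t ` U t) (\<phi> t) \<theta>"
    proof (intro exI homeomorphismI)
      \<comment> \<open>The level set in \<open>W\<close> is a graph, so the inverse just forgets
        the \<open>i\<close>-th coordinate.\<close>
      show "continuous_on (\<phi> t ` U t) (\<lambda>x. \<chi> k. x $ \<sigma> k)"
        by (intro continuous_on_vec_lambda continuous_intros)
    qed (use cont\<phi> \<phi>_nth in \<open>auto simp: vec_eq_iff image_iff\<close>)
  qed simp
  have gram: "gram_density (\<phi> t) y = norm (G (\<phi> t y)) * inverse \<bar>G (\<phi> t y) $ i\<bar>" if y: "y \<in> U t" for t y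
  proof -
    let ?x = "\<phi> t y"
    have Gi: "G ?x $ i \<noteq> 0"
      using GW \<phi>W[OF y] by blast
    \<comment> \<open>By implicit differentiation, \<open>- q\<close> is the gradient of the
      function whose graph the level set is.\<close>
    define q where "q = (\<chi> k. G ?x $ \<sigma> k / G ?x $ i)"
    let ?M = "matrix (frechet_derivative (\<phi> t) (at y))"
    have col: "G ?x \<bullet> insert_coord i \<sigma> (axis k 1, 0) = G ?x $ \<sigma> k" for k
      by (simp add: inner_vec_def sum_coord[OF \<sigma>] axis_def if_distrib cong: if_cong)
    have M: "?M $ i $ k = - q $ k" "?M $ \<sigma> l $ k = (if l = k then 1 else 0)" for k l
      by (simp_all add: matrix_def fder[OF y] c_def col q_def) (simp add: axis_def)
    have "transpose ?M ** ?M = (\<chi> k l. (if k = l then 1 else 0) + q $ k * q $ l)"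
      by (simp add: vec_eq_iff matrix_matrix_mult_def transpose_def sum_coord[OF \<sigma>] M mult_if_delta)
    then have "gram_density (\<phi> t) y = sqrt (1 + (norm q)\<^sup>2)"
      unfolding gram_density_def Let_def by (simp add: det_identity_plus_outer)
    also have "1 + (norm q)\<^sup>2 = (norm (G ?x) * inverse \<bar>G ?x $ i\<bar>)\<^sup>2"
    proof -
      have "(norm q)\<^sup>2 = (\<Sum>k\<in>UNIV. (G ?x $ \<sigma> k)\<^sup>2) / (G ?x $ i)\<^sup>2"
        unfolding power2_norm_eq_inner inner_vec_def q_def by (simp add: power2_eq_square sum_divide_distrib)
      moreover have "(norm (G ?x))\<^sup>2 = (G ?x $ i)\<^sup>2 + (\<Sum>k\<in>UNIV. (G ?x $ \<sigma> k)\<^sup>2)"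
        unfolding power2_norm_eq_inner inner_vec_def by (simp add: power2_eq_square sum_coord[OF \<sigma>])
      ultimately show ?thesis
        using Gi by (simp add: power_mult_distrib field_simps)
    qed
    finally show ?thesis by simp
  qed
  have Gm [measurable]: "G \<in> borel_measurable borel"
    using cont by (rule borel_measurable_continuous_onI)
  have [measurable]: "(\<lambda>x. G x $ i) \<in> borel_measurable borel"
    by (intro borel_measurable_continuous_onI continuous_on_component cont)
  have Vm [measurable]: "V \<in> sets borel" and Wm [measurable]: "W \<in> sets borel"
    using V W(1) by auto
  have \<Psi>m: "(\<lambda>z. indicator V z *\<^sub>R \<Psi> z) \<in> borel_measurable borel"
    using hom by (intro borel_measurable_continuous_on_indicator) (auto simp: homeomorphism_def)
  have main: "(\<lambda>t. \<integral>\<^sup>+x\<in>W \<inter> H -` {t}. g x * ennreal (inverse (norm (G x))) \<partial>inductive_volume TYPE('m)) \<in> borel_measurable borel \<and>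
      (\<integral>\<^sup>+x\<in>W. g x \<partial>lborel)
        = (\<integral>\<^sup>+t. (\<integral>\<^sup>+x\<in>W \<inter> H -` {t}. g x * ennreal (inverse (norm (G x))) \<partial>inductive_volume TYPE('m)) \<partial>lborel)"
    if g [measurable]: "g \<in> borel_measurable borel" for g
  proof -
    define h where "h x = g x * ennreal (inverse \<bar>G x $ i\<bar>)" for x
    \<comment> \<open>The inner indicator makes \<open>\<Psi>\<close> a total Borel map, the outer
      one removes the default value.\<close>
    define K where "K z = h (indicator V z *\<^sub>R \<Psi> z) * indicator V z" for z
    have [measurable]: "h \<in> borel_measurable borel"
      unfolding h_def by measurable
    have [measurable]: "K \<in> borel_measurable borel"
      unfolding K_def using \<Psi>m by measurable
    have slice: "(\<integral>\<^sup>+x\<in>W \<inter> H -` {t}. g x * ennreal (inverse (norm (G x))) \<partial>inductive_volume TYPE('m))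
        = (\<integral>\<^sup>+y. K (insert_coord i \<sigma> (y, t)) \<partial>lborel)" for t
    proof -
      have "(\<integral>\<^sup>+x\<in>\<phi> t ` U t. g x * ennreal (inverse (norm (G x))) \<partial>inductive_volume TYPE('m))
          = (\<integral>\<^sup>+y\<in>U t. ennreal (gram_density (\<phi> t) y) * (g (\<phi> t y) * ennreal (inverse (norm (G (\<phi> t y))))) \<partial>lborel)"
        by (rule nn_integral_inductive_volume_chart[OF chart]) measurable
      also have "\<dots> = (\<integral>\<^sup>+y. K (insert_coord i \<sigma> (y, t)) \<partial>lborel)"
      proof (rule nn_integral_cong)
        fix y :: "real ^ 'm"
        show "ennreal (gram_density (\<phi> t) y) * (g (\<phi> t y) * ennreal (inverse (norm (G (\<phi> t y))))) * indicator (U t) y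
            = K (insert_coord i \<sigma> (y, t))"
        proof (cases "y \<in> U t")
          case True
          have "G (\<phi> t y) \<noteq> 0"
            using GW[OF \<phi>W[OF True]] by auto
          \<comment> \<open>The norms of the gradient cancel; the inverse of the absolute Jacobian
            of \<open>\<Phi>\<close> remains.\<close>
          then have "ennreal (gram_density (\<phi> t) y) * ennreal (inverse (norm (G (\<phi> t y)))) = ennreal (inverse \<bar>G (\<phi> t y) $ i\<bar>)"
            unfolding gram[OF True] by (subst ennreal_mult'[symmetric]) simp_all
          moreover have "insert_coord i \<sigma> (y, t) \<in> V"
            using True by (simp add: U_def)
          ultimately show ?thesis
            using True by (subst mult.left_commute) (simp add: K_def h_def \<phi>_def)
        next
          case False
          then show ?thesis by (simp add: K_def U_def)
        qed
      qed
      finally show ?thesis by (simp add: im)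
    qed
    have eq: "ennreal \<bar>det (matrix (\<Phi>' x))\<bar> * K (\<Phi> x) * indicator W x = g x * indicator W x" for x
    proof -
      \<comment> \<open>The identity with row \<open>i\<close> replaced by \<open>G x\<close>, in
        the form that \<open>cramer_lemma_transpose\<close> expects.\<close>
      have "matrix (\<Phi>' x) = (\<chi> j. if j = i then sum (\<lambda>l. G x $ l *s row l (mat 1)) UNIV else row j (mat 1))"
      proof -
        have "sum (\<lambda>l. G x $ l *s row l (mat 1)) UNIV = G x"
          by (simp add: vec_eq_iff row_def mat_def if_distrib cong: if_cong)
        moreover have "(G x - e) \<bullet> axis j 1 = G x $ j - e $ j" for j
          by (simp add: inner_axis)
        ultimately show ?thesis
          by (simp add: vec_eq_iff matrix_def \<Phi>'_def row_def mat_def) (simp add: e_def axis_def)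
      qed
      then have "det (matrix (\<Phi>' x)) = G x $ i"
        by (simp add: cramer_lemma_transpose)
      moreover have "ennreal \<bar>G x $ i\<bar> * (g x * ennreal (inverse \<bar>G x $ i\<bar>)) = g x" if "x \<in> W"
      proof -
        have "ennreal \<bar>G x $ i\<bar> * ennreal (inverse \<bar>G x $ i\<bar>) = 1"
          using GW[OF that] by (subst ennreal_mult[symmetric]) simp_all
        then show ?thesis by (metis mult.left_commute mult.right_neutral)
      qed
      ultimately show ?thesis
        using \<Phi>V[of x] by (auto simp: K_def h_def indicator_def)
    qed
    have \<Phi>W: "\<Phi> ` W = V"
      using hom by (simp add: homeomorphism_def)
    have "(\<integral>\<^sup>+x\<in>W. g x \<partial>lborel) = (\<integral>\<^sup>+x\<in>W. ennreal \<bar>det (matrix (\<Phi>' x))\<bar> * K (\<Phi> x) \<partial>lborel)"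
      unfolding eq ..
    also have "\<dots> = (\<integral>\<^sup>+z\<in>\<Phi> ` W. K z \<partial>lborel)"
    proof (rule nn_integral_change_of_variables[symmetric])
      show "(\<Phi> has_derivative \<Phi>' x) (at x within W)" for x
        by (rule has_derivative_at_withinI[OF der\<Phi>])
      show "inj_on \<Phi> W"
        by (rule inj_on_inverseI[of _ \<Psi>]) (rule \<Phi>V)
      show "(\<lambda>x. ennreal \<bar>det (matrix (\<Phi>' x))\<bar> * K (\<Phi> x) * indicator W x) \<in> borel_measurable borel"
        unfolding eq by measurable
    qed (simp_all add: \<Phi>W)
    also note \<Phi>W
    also have "(\<integral>\<^sup>+z\<in>V. K z \<partial>lborel) = (\<integral>\<^sup>+z. K z \<partial>lborel)"
      by (rule nn_integral_cong) (simp add: K_def indicator_def)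
    finally show ?thesis
      unfolding slice using nn_integral_insert_coord[OF \<sigma> \<open>K \<in> borel_measurable borel\<close>] by simp
  qed
  have "W \<subseteq> {x. G x \<noteq> 0}"
    using GW by force
  then show ?thesis
    using W main by (intro exI[of _ W]) blast
qed

text \<open>\<open>local_coarea\<close> is summed over a countable subcover made disjoint. The parts
  \<open>D k\<close> need not be open, so the neighbourhood \<open>W k\<close> stays and the
  restriction moves into the integrand; this is why \<open>P\<close> quantifies over all
  integrands.\<close>

lemma nn_integral_coarea:
  fixes H :: "real ^ 'n::finite \<Rightarrow> real" and G :: "real ^ 'n \<Rightarrow> real ^ 'n"
  assumes card: "CARD('n) = Suc CARD('m::finite)"
    and der: "\<And>x. (H has_derivative (\<lambda>v. G x \<bullet> v)) (at x)"
    and cont: "continuous_on UNIV G" and g [measurable]: "g \<in> borel_measurable borel"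
  shows "(\<lambda>t. \<integral>\<^sup>+x\<in>H -` {t}. g x * ennreal (inverse (norm (G x))) \<partial>inductive_volume TYPE('m)) \<in> borel_measurable borel"
    and "(\<integral>\<^sup>+x\<in>{x. G x \<noteq> 0}. g x \<partial>lborel)
      = (\<integral>\<^sup>+t. (\<integral>\<^sup>+x\<in>H -` {t}. g x * ennreal (inverse (norm (G x))) \<partial>inductive_volume TYPE('m)) \<partial>lborel)"
proof -
  let ?\<mu> = "inductive_volume TYPE('m)"
  let ?I = "\<lambda>W g t. \<integral>\<^sup>+x\<in>W \<inter> H -` {t}. g x * ennreal (inverse (norm (G x))) \<partial>?\<mu>"
  define P where "P W \<longleftrightarrow> open W \<and> W \<subseteq> {x. G x \<noteq> 0} \<and> (\<forall>g\<in>borel_measurable borel.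
      ?I W g \<in> borel_measurable borel \<and> (\<integral>\<^sup>+x\<in>W. g x \<partial>lborel) = (\<integral>\<^sup>+t. ?I W g t \<partial>lborel))" for W
  have Gm [measurable]: "G \<in> borel_measurable borel"
    using cont by (rule borel_measurable_continuous_onI)
  have [measurable]: "H \<in> borel_measurable borel"
    by (intro borel_measurable_continuous_onI continuous_at_imp_continuous_on ballI has_derivative_continuous[OF der])
  have "\<Union>{W. P W} = {x. G x \<noteq> 0}"
  proof
    show "{x. G x \<noteq> 0} \<subseteq> \<Union>{W. P W}"
    proof
      fix x assume "x \<in> {x. G x \<noteq> 0}"
      then have "G x \<noteq> 0" by simp
      from local_coarea[OF card der cont this] show "x \<in> \<Union>{W. P W}"
        unfolding P_def by blast
    qed
  qed (auto simp: P_def)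
  moreover obtain \<F> where \<F>: "\<F> \<subseteq> {W. P W}" "countable \<F>" "\<Union>\<F> = \<Union>{W. P W}"
    by (rule Lindelof[of "{W. P W}"]) (simp add: P_def)
  moreover have "P {}"
    by (simp add: P_def)
  have "\<exists>W :: nat \<Rightarrow> _. (\<forall>k. P (W k)) \<and> \<F> \<subseteq> range W"
    by (rule countable_enumeration[where d = "{}" and P = P]) (use \<F>(1,2) \<open>P {}\<close> in blast)+
  then obtain W :: "nat \<Rightarrow> _" where W: "\<forall>k. P (W k)" "\<F> \<subseteq> range W"
    by (elim exE conjE)
  moreover have "\<Union>(range W) \<subseteq> \<Union>{W. P W}"
    using W(1) by blast
  ultimately have WU: "(\<Union>k. W k) = {x. G x \<noteq> 0}"
    by (metis Union_mono subset_antisym)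
  have Wm: "range W \<subseteq> sets borel"
    using W(1) by (auto simp: P_def)
  define D where "D = disjointed W"
  have Dm [measurable]: "D k \<in> sets borel" for k
    using sets.range_disjointed_sets[OF Wm] by (auto simp: D_def)
  have DW: "D k \<subseteq> W k" for k
    unfolding D_def by (rule disjointed_subset)
  have gD [measurable]: "(\<lambda>x. g x * indicator (D k) x) \<in> borel_measurable borel" for k
    by measurable
  have sum_D: "(\<Sum>k. indicator (D k) x) = (indicator {x. G x \<noteq> 0} x :: ennreal)" for x
    using suminf_indicator[OF disjoint_family_disjointed[of W], of x] by (simp add: D_def UN_disjointed_eq WU)
  have *: "(\<integral>\<^sup>+x\<in>H -` {t}. g x * ennreal (inverse (norm (G x))) \<partial>?\<mu>)
      = (\<Sum>k. ?I (W k) (\<lambda>x. g x * indicator (D k) x) t)" for t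
  proof -
    have "(\<integral>\<^sup>+x\<in>H -` {t}. g x * ennreal (inverse (norm (G x))) \<partial>?\<mu>)
        = (\<integral>\<^sup>+x. (\<Sum>k. g x * ennreal (inverse (norm (G x))) * indicator (H -` {t}) x * indicator (D k) x) \<partial>?\<mu>)"
      \<comment> \<open>At critical points the weight is already \<open>inverse 0 = 0\<close>, so
        multiplying by the sum of the indicators changes nothing.\<close>
      unfolding ennreal_suminf_cmult sum_D by (rule nn_integral_cong) (auto simp: indicator_def)
    also have "\<dots> = (\<Sum>k. \<integral>\<^sup>+x. g x * ennreal (inverse (norm (G x))) * indicator (H -` {t}) x * indicator (D k) x \<partial>?\<mu>)"
      by (rule nn_integral_suminf) measurable
    also have "\<dots> = (\<Sum>k. ?I (W k) (\<lambda>x. g x * indicator (D k) x) t)"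
      using DW by (intro suminf_cong nn_integral_cong) (auto simp: indicator_def)
    finally show ?thesis .
  qed
  have I: "?I (W k) (\<lambda>x. g x * indicator (D k) x) \<in> borel_measurable borel"
    "(\<integral>\<^sup>+x\<in>W k. g x * indicator (D k) x \<partial>lborel) = (\<integral>\<^sup>+t. ?I (W k) (\<lambda>x. g x * indicator (D k) x) t \<partial>lborel)" for k
    using bspec[OF conjunct2[OF conjunct2[OF spec[OF W(1), unfolded P_def]]] gD] by simp_all
  show "(\<lambda>t. \<integral>\<^sup>+x\<in>H -` {t}. g x * ennreal (inverse (norm (G x))) \<partial>?\<mu>) \<in> borel_measurable borel"
    unfolding * using I(1) by (intro borel_measurable_suminf_order)
  have "(\<integral>\<^sup>+x\<in>{x. G x \<noteq> 0}. g x \<partial>lborel) = (\<integral>\<^sup>+x. (\<Sum>k. g x * indicator (D k) x) \<partial>lborel)"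
    unfolding ennreal_suminf_cmult sum_D ..
  also have "\<dots> = (\<Sum>k. \<integral>\<^sup>+x. g x * indicator (D k) x \<partial>lborel)"
    by (rule nn_integral_suminf) measurable
  also have "\<dots> = (\<Sum>k. \<integral>\<^sup>+x\<in>W k. g x * indicator (D k) x \<partial>lborel)"
    using DW by (intro suminf_cong nn_integral_cong) (auto simp: indicator_def)
  also have "\<dots> = (\<integral>\<^sup>+t. (\<Sum>k. ?I (W k) (\<lambda>x. g x * indicator (D k) x) t) \<partial>lborel)"
    unfolding I(2) using I(1) by (intro nn_integral_suminf[symmetric]) simp
  finally show "(\<integral>\<^sup>+x\<in>{x. G x \<noteq> 0}. g x \<partial>lborel)
      = (\<integral>\<^sup>+t. (\<integral>\<^sup>+x\<in>H -` {t}. g x * ennreal (inverse (norm (G x))) \<partial>?\<mu>) \<partial>lborel)"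
    unfolding * .
qed

lemma smooth_has_derivative_grad:
  fixes H :: "real ^ 'n::finite \<Rightarrow> real"
  assumes "smooth H"
  shows "(H has_derivative (\<lambda>v. grad H x \<bullet> v)) (at x)" and "continuous_on UNIV (grad H)"
proof -
  have C1: "Ck_on (Suc 0) UNIV H"
    using assms unfolding smooth_def by blast
  then have D: "(H has_derivative frechet_derivative H (at x)) (at x)"
    by (simp add: frechet_derivative_works)
  have "frechet_derivative H (at x) = (\<lambda>v. grad H x \<bullet> v)"
  proof
    fix v
    have "frechet_derivative H (at x) v = frechet_derivative H (at x) (\<Sum>i\<in>UNIV. v $ i *\<^sub>R axis i 1)"
      using basis_expansion[of v] by (simp add: scalar_mult_eq_scaleR)
    also have "\<dots> = (\<Sum>i\<in>UNIV. v $ i * frechet_derivative H (at x) (axis i 1))"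
      by (simp only: linear_sum[OF has_derivative_linear[OF D]] linear_scale[OF has_derivative_linear[OF D]] real_scaleR_def)
    finally show "frechet_derivative H (at x) v = grad H x \<bullet> v"
      by (simp add: grad_def inner_vec_def mult.commute)
  qed
  with D show "(H has_derivative (\<lambda>v. grad H x \<bullet> v)) (at x)"
    by simp
  show "continuous_on UNIV (grad H)"
    unfolding grad_def using C1 by (intro continuous_on_vec_lambda) auto
qed

section \<open>From nonnegative to integrable functions\<close>

text \<open>In this form an inner Bochner integral inherits measurability in the level from
  nonnegative integrals. The value 0 is the convention for non-integrable functions.\<close>

lemma integral_eq_enn2real_diff:
  fixes f :: "'a \<Rightarrow> real"
  assumes "f \<in> borel_measurable M"
  shows "integral\<^sup>L M f = (if (\<integral>\<^sup>+x. ennreal \<bar>f x\<bar> \<partial>M) < \<infinity>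
    then enn2real (\<integral>\<^sup>+x. ennreal (f x) \<partial>M) - enn2real (\<integral>\<^sup>+x. ennreal (- f x) \<partial>M) else 0)"
proof (cases "(\<integral>\<^sup>+x. ennreal \<bar>f x\<bar> \<partial>M) < \<infinity>")
  case True
  then have "integrable M f"
    using assms by (simp add: integrable_iff_bounded)
  then show ?thesis
    using True by (simp add: real_lebesgue_integral_def)
next
  case False
  then have "\<not> integrable M f"
    by (simp add: integrable_iff_bounded)
  then show ?thesis
    using False by (simp add: not_integrable_integral_eq)
qed

text \<open>A critical set of positive measure between the levels, as for constant \<open>H\<close>,
  would count on the left but not on the right; the almost-everywhere hypothesis on
  \<open>grad H\<close> excludes it. The integrability clauses ensure that the iterated integral is
  not a default value 0 in disguise.\<close>

theorem theorem3p3: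
  fixes H f :: "real ^ 'n::finite \<Rightarrow> real" and a b :: real
  assumes "CARD('n) \<ge> 2" and "CARD('m::finite) = CARD('n) - 1"
    and "smooth H"
    and "a < b"
    and "AE x in lborel. H x \<in> {a..b} \<longrightarrow> grad H x \<noteq> 0"
    and "integrable lborel f"
  shows "(AE t in lborel. t \<in> {a..b} \<longrightarrow>
            set_integrable (inductive_volume TYPE('m)) (H -` {t}) (\<lambda>x. f x / norm (grad H x))) \<and>
         set_integrable lborel {a..b}
            (\<lambda>t. LINT x:H -` {t}|inductive_volume TYPE('m). f x / norm (grad H x)) \<and>
         (LINT x:H -` {a..b}|lborel. f x) =
         (LINT t:{a..b}|lborel. LINT x:H -` {t}|inductive_volume TYPE('m). f x / norm (grad H x))"
proof -
  let ?\<mu> = "inductive_volume TYPE('m)" and ?A = "H -` {a..b}"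
  have card: "CARD('n) = Suc CARD('m)"
    using assms(1,2) by simp
  note der = smooth_has_derivative_grad(1)[OF assms(3)] and cont = smooth_has_derivative_grad(2)[OF assms(3)]
  have [measurable]: "grad H \<in> borel_measurable borel"
    using cont by (rule borel_measurable_continuous_onI)
  have [measurable]: "H \<in> borel_measurable borel"
    by (intro borel_measurable_continuous_onI continuous_at_imp_continuous_on ballI has_derivative_continuous[OF der])
  have f [measurable]: "f \<in> borel_measurable borel"
    using borel_measurable_integrable[OF assms(6)] by simp
  define J where "J g t = (\<integral>\<^sup>+x\<in>H -` {t}. g x * ennreal (inverse (norm (grad H x))) \<partial>?\<mu>)" for g t
  have J_meas [measurable]: "J g \<in> borel_measurable borel" if "g \<in> borel_measurable borel" for g
    unfolding J_def by (rule nn_integral_coarea(1)[OF card der cont that])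
  have J_meas': "(\<lambda>t. J g t * indicator {a..b} t) \<in> borel_measurable lborel" if "g \<in> borel_measurable borel" for g
  proof -
    note [measurable] = J_meas[OF that]
    show ?thesis by measurable
  qed
  have J_int: "(\<integral>\<^sup>+t\<in>{a..b}. J g t \<partial>lborel) = (\<integral>\<^sup>+x\<in>?A. g x \<partial>lborel)"
    if g [measurable]: "g \<in> borel_measurable borel" for g
  proof -
    \<comment> \<open>A level set lies entirely inside or entirely outside the slab, so the
      restriction moves from the level to the integrand.\<close>
    have "(\<integral>\<^sup>+t\<in>{a..b}. J g t \<partial>lborel) = (\<integral>\<^sup>+t. J (\<lambda>x. g x * indicator ?A x) t \<partial>lborel)"
    proof (rule nn_integral_cong)
      fix t
      show "J g t * indicator {a..b} t = J (\<lambda>x. g x * indicator ?A x) t"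
        unfolding J_def by (cases "t \<in> {a..b}") (auto intro!: nn_integral_cong simp: indicator_def nn_integral_0_iff_AE)
    qed
    also have "\<dots> = (\<integral>\<^sup>+x\<in>{x. grad H x \<noteq> 0}. g x * indicator ?A x \<partial>lborel)"
      unfolding J_def by (rule nn_integral_coarea(2)[OF card der cont, symmetric]) measurable
    \<comment> \<open>The critical points in the slab form a null set by the hypothesis on
      \<open>grad H\<close>.\<close>
    also have "\<dots> = (\<integral>\<^sup>+x\<in>?A. g x \<partial>lborel)"
      using assms(5) by (intro nn_integral_cong_AE) (auto simp: indicator_def elim!: eventually_mono)
    finally show ?thesis .
  qed
  define F where "F t x = indicator (H -` {t}) x *\<^sub>R (f x / norm (grad H x))" for t x
  have F_meas: "F t \<in> borel_measurable ?\<mu>" for t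
    unfolding F_def by measurable
  have J_F: "(\<integral>\<^sup>+x. ennreal (F t x) \<partial>?\<mu>) = J (\<lambda>x. ennreal (f x)) t"
    "(\<integral>\<^sup>+x. ennreal (- F t x) \<partial>?\<mu>) = J (\<lambda>x. ennreal (- f x)) t"
    "(\<integral>\<^sup>+x. ennreal \<bar>F t x\<bar> \<partial>?\<mu>) = J (\<lambda>x. ennreal \<bar>f x\<bar>) t" for t
    unfolding J_def F_def
    by (auto intro!: nn_integral_cong simp: indicator_def divide_inverse ennreal_mult''[symmetric] abs_mult)
  have int_abs: "(\<integral>\<^sup>+x. ennreal \<bar>f x\<bar> \<partial>lborel) < \<infinity>"
    using assms(6) by (simp add: integrable_iff_bounded)
  have finite: "(\<integral>\<^sup>+t\<in>{a..b}. J (\<lambda>x. ennreal (h x)) t \<partial>lborel) < \<infinity>"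
    if "\<And>x. h x \<le> \<bar>f x\<bar>" "h \<in> borel_measurable borel" for h
  proof -
    have "(\<integral>\<^sup>+t\<in>{a..b}. J (\<lambda>x. ennreal (h x)) t \<partial>lborel) = (\<integral>\<^sup>+x\<in>?A. ennreal (h x) \<partial>lborel)"
      using that(2) by (intro J_int) measurable
    also have "\<dots> \<le> (\<integral>\<^sup>+x. ennreal \<bar>f x\<bar> \<partial>lborel)"
      using that(1) by (intro nn_integral_mono) (auto simp: indicator_def ennreal_leI)
    finally show ?thesis
      using int_abs by simp
  qed
  have AE_fin: "AE t in lborel. J (\<lambda>x. ennreal \<bar>f x\<bar>) t * indicator {a..b} t \<noteq> \<infinity>"
    using finite[of "\<lambda>x. \<bar>f x\<bar>"] by (intro nn_integral_noteq_infinite J_meas') auto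
  define L where "L t = (LINT x:H -` {t}|?\<mu>. f x / norm (grad H x))" for t
  have L: "L t = (if J (\<lambda>x. ennreal \<bar>f x\<bar>) t < \<infinity>
      then enn2real (J (\<lambda>x. ennreal (f x)) t) - enn2real (J (\<lambda>x. ennreal (- f x)) t) else 0)" for t
    unfolding L_def set_lebesgue_integral_def F_def[symmetric]
    by (simp only: integral_eq_enn2real_diff[OF F_meas] J_F)
  have part1: "AE t in lborel. t \<in> {a..b} \<longrightarrow> set_integrable ?\<mu> (H -` {t}) (\<lambda>x. f x / norm (grad H x))"
    using AE_fin
  proof eventually_elim
    case (elim t)
    show ?case
    proof
      assume "t \<in> {a..b}"
      then have "J (\<lambda>x. ennreal \<bar>f x\<bar>) t < \<infinity>"
        using elim by (simp add: top.not_eq_extremum)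
      then have "integrable ?\<mu> (F t)"
        using F_meas J_F(3) by (simp add: integrable_iff_bounded)
      then show "set_integrable ?\<mu> (H -` {t}) (\<lambda>x. f x / norm (grad H x))"
        by (simp add: set_integrable_def F_def[abs_def])
    qed
  qed
  \<comment> \<open>\<open>enn2real\<close> sends infinity to 0; for \<open>h\<close> as in the next
    claim this affects only a null set of levels.\<close>
  define u where "u h t = enn2real (J (\<lambda>x. ennreal (h x)) t * indicator {a..b} t)" for h t
  have u: "integrable lborel (u h)" "integral\<^sup>L lborel (u h) = enn2real (\<integral>\<^sup>+x\<in>?A. ennreal (h x) \<partial>lborel)"
    if h: "\<And>x. h x \<le> \<bar>f x\<bar>" "h \<in> borel_measurable borel" for h
  proof -
    have [measurable]: "h \<in> borel_measurable borel" by (rule h(2))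
    have "AE t in lborel. J (\<lambda>x. ennreal (h x)) t * indicator {a..b} t \<noteq> \<infinity>"
      using finite[OF h] by (intro nn_integral_noteq_infinite J_meas') auto
    then have eq: "(\<integral>\<^sup>+t. ennreal (u h t) \<partial>lborel) = (\<integral>\<^sup>+t\<in>{a..b}. J (\<lambda>x. ennreal (h x)) t \<partial>lborel)"
      by (intro nn_integral_cong_AE) (auto simp: u_def top.not_eq_extremum elim!: eventually_mono)
    have um: "u h \<in> borel_measurable lborel"
      unfolding u_def by measurable
    show "integrable lborel (u h)"
      using um finite[OF h] by (intro integrableI_nonneg) (simp_all add: eq, simp add: u_def)
    have "integral\<^sup>L lborel (u h) = enn2real (\<integral>\<^sup>+t. ennreal (u h t) \<partial>lborel)"
      using um by (intro integral_eq_nn_integral) (auto simp: u_def)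
    then show "integral\<^sup>L lborel (u h) = enn2real (\<integral>\<^sup>+x\<in>?A. ennreal (h x) \<partial>lborel)"
      unfolding eq using J_int[of "\<lambda>x. ennreal (h x)"] h(2) by simp
  qed
  have u_f: "integrable lborel (u f)" "integrable lborel (u (\<lambda>x. - f x))"
    by (intro u; simp)+
  have L_meas: "(\<lambda>t. indicator {a..b} t *\<^sub>R L t) \<in> borel_measurable lborel"
    unfolding L by measurable
  \<comment> \<open>Only almost everywhere: on a non-integrable slice \<open>L\<close> is 0 by
    convention, while the difference of the two parts need not be.\<close>
  have L_AE: "AE t in lborel. u f t - u (\<lambda>x. - f x) t = indicator {a..b} t *\<^sub>R L t"
    using AE_fin by eventually_elim (auto simp: u_def L indicator_def top.not_eq_extremum)
  have L_int: "integrable lborel (\<lambda>t. indicator {a..b} t *\<^sub>R L t)"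
    using integrable_cong_AE_imp[OF Bochner_Integration.integrable_diff[OF u_f] L_meas] L_AE by (auto elim: eventually_mono)
  have "(LINT t:{a..b}|lborel. L t) = integral\<^sup>L lborel (\<lambda>t. u f t - u (\<lambda>x. - f x) t)"
    unfolding set_lebesgue_integral_def using u_f L_meas L_AE
    by (intro integral_cong_AE) (auto elim: eventually_mono)
  also have "\<dots> = enn2real (\<integral>\<^sup>+x\<in>?A. ennreal (f x) \<partial>lborel) - enn2real (\<integral>\<^sup>+x\<in>?A. ennreal (- f x) \<partial>lborel)"
    by (subst Bochner_Integration.integral_diff[OF u_f]) (simp add: u(2))
  also have "\<dots> = (LINT x:?A|lborel. f x)"
  proof -
    have "integrable lborel (\<lambda>x. indicator ?A x *\<^sub>R f x)"
      using measurable_sets[OF \<open>H \<in> borel_measurable borel\<close>, of "{a..b}"]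
      by (intro integrable_mult_indicator assms(6)) simp
    then show ?thesis
      unfolding set_lebesgue_integral_def
      by (simp add: real_lebesgue_integral_def)
         (intro arg_cong2[where f = "(-)"] arg_cong[where f = enn2real] nn_integral_cong; simp add: indicator_def)
  qed
  finally show ?thesis
    using part1 L_int by (simp add: L_def set_integrable_def)
qed

end
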